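(* Let $F:\mathcal X\to[0,\infty]$ be a monotone functional which is lower semicontinuous with respect to the box topology. Let $G:\Pi\to[0,\infty]$ be a monotone functional which is lower semicontinuous with respect to the weak topology, and suppose that $G$ is an extension of $F$, i.e. $G(\mathcal PX)=F(X)$ for all $X\in\mathcal X$. Then $$G(P)=\sup_{X\in P}F(X)\qquad\text{for every }P\in\Pi.$$
   Context: A pm-space is a triple $X=(X,d_X,m_X)$ with $(X,d_X)$ a complete separable metric space and $m_X$ a Borel probability measure. Two pm-spaces are isomorphic if there is an isometry $\operatorname{supp} m_X\to\operatorname{supp} m_Y$ pushing $m_X$ forward to $m_Y$; $\mathcal X$ is the set of isomorphism classes, and a class is always represented by a space with $\operatorname{supp}m_X=X$. Lipschitz order: $Y\prec X$ iff there is a $1$-Lipschitz map $\phi:X\to Y$ with $\phi_\#m_X=m_Y$. Box distance: a parameter of $X$ is a Borel map $a:[0,1]\to X$ with $a_\#\mathcal L^1=m_X$; $\square(X,Y)$ is the infimum of $\epsilon>0$ such that there are parameters $a$ of $X$, $b$ of $Y$ and a Borel set $I_0\subset[0,1]$ with $\mathcal L^1(I_0)\ge1-\epsilon$ and $|d_X(a(s),a(t))-d_Y(b(s),b(t))|\le\epsilon$ for all $s,t\in I_0$; it induces the box topology on $\mathcal X$. A pyramid is a non-empty, $\square$-closed subset $P\subset\mathcal X$ that is downward-closed for $\prec$ and directed (any $X,Y\in P$ have some $Z\in P$ with $X,Y\prec Z$). $\Pi$ is the set of pyramids; $\mathcal PX=\{Y\in\mathcal X\mid Y\prec X\}\in\Pi$.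 Pyramids $P_n$ converge weakly to $P$ if (1) every $X\in P$ is a $\square$-limit of some $X_n\in P_n$, and (2) $\liminf_n\inf_{Y\in P_n}\square(X,Y)>0$ for every $X\notin P$; this is convergence for a compact metrizable topology on $\Pi$ (the weak topology). $F:\mathcal X\to[0,\infty]$ is monotone if $X\prec Y$ implies $F(X)\le F(Y)$; $G:\Pi\to[0,\infty]$ is monotone if $P\subset Q$ implies $G(P)\le G(Q)$. *)

theory Defs
  imports "HOL-Probability.Probability"
begin

section \<open>pm-spaces and their isomorphism classes\<close>

definition is_pm_space :: "'a metric \<Rightarrow> 'a measure \<Rightarrow> bool" where
  "is_pm_space d m \<longleftrightarrow>
     mcomplete_of d \<and>
     separable_space (mtopology_of d) \<and>
     space m = mspace d \<and>
     sets m = sigma_sets (mspace d) {U. openin (mtopology_of d) U} \<and>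
     prob_space m"

lemma is_pm_space_point:
  "is_pm_space (metric ({x}, \<lambda>_ _. 0)) (return (sigma {x} (Pow {x})) x)"
proof -
  have M: "Metric_space {x} (\<lambda>_ _. 0)"
    by (simp add: Metric_space_def)
  define T where "T = Metric_space.mtopology {x} (\<lambda>_ _. 0)"
  have top: "topspace T = {x}"
    unfolding T_def by (rule Metric_space.topspace_mtopology[OF M])
  have opens: "{U. openin T U} = Pow {x}"
  proof (intro equalityI subsetI)
    fix U assume "U \<in> {U. openin T U}"
    then show "U \<in> Pow {x}"
      using openin_subset[of T U] top by simp
  next
    fix U assume "U \<in> Pow {x}"
    then have "U = {} \<or> U = topspace T" using top by auto
    then show "U \<in> {U. openin T U}" using openin_empty openin_topspace by blast
  qed
  have sets: "sigma_sets {x} (Pow {x}) = Pow {x}"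
    using sigma_algebra.sigma_sets_eq[OF sigma_algebra_Pow] .
  have "compact_space T"
    unfolding compact_space_def by (rule finite_imp_compactin) (simp_all add: top)
  then have complete: "Metric_space.mcomplete {x} (\<lambda>_ _. 0)"
    using Metric_space.compact_space_imp_mcomplete[OF M] by (simp add: T_def)
  have separable: "separable_space T"
    unfolding separable_space_def
    using closure_of_topspace[of T] top by (intro exI[of _ "{x}"]) simp
  have prob: "prob_space (return (sigma {x} (Pow {x})) x)"
    by (rule prob_space_return) simp
  show ?thesis
    unfolding is_pm_space_def Metric_space.mcomplete_of[OF M] Metric_space.mtopology_of[OF M]
      Metric_space.mspace_metric[OF M] T_def[symmetric]
    using complete separable prob by (simp add: opens sets)
qed

typedef 'a pm_space = "{(d :: 'a metric, m). is_pm_space d m}"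
  using is_pm_space_point by fast

definition pm_metric :: "'a pm_space \<Rightarrow> 'a metric" where
  "pm_metric X = fst (Rep_pm_space X)"

definition pm_measure :: "'a pm_space \<Rightarrow> 'a measure" where
  "pm_measure X = snd (Rep_pm_space X)"

abbreviation pm_dist :: "'a pm_space \<Rightarrow> 'a \<Rightarrow> 'a \<Rightarrow> real" where
  "pm_dist X \<equiv> mdist (pm_metric X)"

abbreviation pm_points :: "'a pm_space \<Rightarrow> 'a set" where
  "pm_points X \<equiv> mspace (pm_metric X)"

lemma is_pm_space: "is_pm_space (pm_metric X) (pm_measure X)"
  using Rep_pm_space[of X] by (auto simp: pm_metric_def pm_measure_def)

lemma space_pm_measure: "space (pm_measure X) = pm_points X"
  using is_pm_space[of X] by (simp add: is_pm_space_def)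

lemma sets_pm_measure:
  "sets (pm_measure X) = sigma_sets (pm_points X) {U. openin (mtopology_of (pm_metric X)) U}"
  using is_pm_space[of X] by (simp add: is_pm_space_def)

definition pm_support :: "'a pm_space \<Rightarrow> 'a set" where
  "pm_support X = {x \<in> pm_points X.
     \<forall>U. openin (mtopology_of (pm_metric X)) U \<and> x \<in> U \<longrightarrow> emeasure (pm_measure X) U > 0}"

definition pm_isomorphism :: "'a pm_space \<Rightarrow> 'b pm_space \<Rightarrow> ('a \<Rightarrow> 'b) \<Rightarrow> bool" where
  "pm_isomorphism X Y \<phi> \<longleftrightarrow>
     bij_betw \<phi> (pm_support X) (pm_support Y) \<and>
     (\<forall>x\<in>pm_support X. \<forall>x'\<in>pm_support X. pm_dist Y (\<phi> x) (\<phi> x') = pm_dist X x x') \<and>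
     \<phi> \<in> restrict_space (pm_measure X) (pm_support X) \<rightarrow>\<^sub>M
          restrict_space (pm_measure Y) (pm_support Y) \<and>
     distr (restrict_space (pm_measure X) (pm_support X))
           (restrict_space (pm_measure Y) (pm_support Y)) \<phi>
       = restrict_space (pm_measure Y) (pm_support Y)"

definition pm_isomorphic :: "'a pm_space \<Rightarrow> 'b pm_space \<Rightarrow> bool" where
  "pm_isomorphic X Y \<longleftrightarrow> (\<exists>\<phi>. pm_isomorphism X Y \<phi>)"

lemma pm_support_subset: "pm_support X \<subseteq> pm_points X"
  by (auto simp: pm_support_def)

lemma pm_isometry_measurable:
  assumes bij: "bij_betw \<phi> (pm_support X) (pm_support Y)"
    and iso: "\<And>x x'. x \<in> pm_support X \<Longrightarrow> x' \<in> pm_support X \<Longrightarrow>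
      pm_dist Y (\<phi> x) (\<phi> x') = pm_dist X x x'"
  shows "\<phi> \<in> restrict_space (pm_measure X) (pm_support X) \<rightarrow>\<^sub>M
              restrict_space (pm_measure Y) (pm_support Y)"
proof (rule measurable_restrict_space2)
  interpret MX: Metric_space "pm_points X" "pm_dist X" by simp
  interpret MY: Metric_space "pm_points Y" "pm_dist Y" by simp
  have into: "\<phi> x \<in> pm_support Y" if "x \<in> pm_support X" for x
    using bij that by (auto simp: bij_betw_def)
  have sp: "space (restrict_space (pm_measure X) (pm_support X)) = pm_support X"
    using pm_support_subset[of X] by (auto simp: space_restrict_space space_pm_measure)
  show "\<phi> \<in> space (restrict_space (pm_measure X) (pm_support X)) \<rightarrow> pm_support Y"
    using into sp by auto
  show "\<phi> \<in> restrict_space (pm_measure X) (pm_support X) \<rightarrow>\<^sub>M pm_measure Y"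
  proof (rule measurable_sigma_sets[OF sets_pm_measure])
    show "{U. openin (mtopology_of (pm_metric Y)) U} \<subseteq> Pow (pm_points Y)"
      using openin_subset by fastforce
    show "\<phi> \<in> space (restrict_space (pm_measure X) (pm_support X)) \<rightarrow> pm_points Y"
      using into sp pm_support_subset[of Y] by auto
    fix U assume "U \<in> {U. openin (mtopology_of (pm_metric Y)) U}"
    then have U: "openin MY.mtopology U"
      by (simp add: mtopology_of_def)
    define V where "V = \<Union>{MX.mball x r | x r. x \<in> pm_support X \<and>
      (\<forall>x'\<in>pm_support X. x' \<in> MX.mball x r \<longrightarrow> \<phi> x' \<in> U)}"
    have "openin MX.mtopology V"
      unfolding V_def by (rule openin_Union) auto
    then have V: "V \<in> sets (pm_measure X)"
      by (auto simp: sets_pm_measure mtopology_of_def)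
    have "\<phi> -` U \<inter> pm_support X = pm_support X \<inter> V"
    proof (intro equalityI subsetI)
      fix x assume x: "x \<in> \<phi> -` U \<inter> pm_support X"
      then obtain r where r: "r > 0" "MY.mball (\<phi> x) r \<subseteq> U"
        using U unfolding MY.openin_mtopology by auto
      have "\<phi> x' \<in> U" if "x' \<in> pm_support X" "x' \<in> MX.mball x r" for x'
      proof -
        have "\<phi> x' \<in> MY.mball (\<phi> x) r"
          using that x into pm_support_subset[of Y] iso[of x x'] by (auto simp: MY.in_mball)
        then show ?thesis using r by auto
      qed
      moreover have "x \<in> MX.mball x r"
        using x r pm_support_subset[of X] by auto
      ultimately show "x \<in> pm_support X \<inter> V"
        using x unfolding V_def by blast
    next
      fix x assume "x \<in> pm_support X \<inter> V"
      then show "x \<in> \<phi> -` U \<inter> pm_support X"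
        unfolding V_def by auto
    qed
    then show "\<phi> -` U \<inter> space (restrict_space (pm_measure X) (pm_support X))
        \<in> sets (restrict_space (pm_measure X) (pm_support X))"
      using V sp by (auto simp: sets_restrict_space)
  qed
qed

lemma pm_isomorphic_refl: "pm_isomorphic X X"
proof -
  have "pm_isomorphism X X (\<lambda>x. x)"
    unfolding pm_isomorphism_def by (auto simp: bij_betw_def distr_id2)
  then show ?thesis
    unfolding pm_isomorphic_def by blast
qed

lemma pm_isomorphic_sym:
  assumes "pm_isomorphic X Y"
  shows "pm_isomorphic Y X"
proof -
  let ?MX = "restrict_space (pm_measure X) (pm_support X)"
  let ?MY = "restrict_space (pm_measure Y) (pm_support Y)"
  obtain \<phi> where \<phi>: "pm_isomorphism X Y \<phi>"
    using assms unfolding pm_isomorphic_def by blast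
  then have bij: "bij_betw \<phi> (pm_support X) (pm_support Y)"
    and iso: "\<And>x x'. x \<in> pm_support X \<Longrightarrow> x' \<in> pm_support X \<Longrightarrow>
      pm_dist Y (\<phi> x) (\<phi> x') = pm_dist X x x'"
    and meas: "\<phi> \<in> ?MX \<rightarrow>\<^sub>M ?MY" and push: "distr ?MX ?MY \<phi> = ?MY"
    unfolding pm_isomorphism_def by blast+
  define \<psi> where "\<psi> = the_inv_into (pm_support X) \<phi>"
  have \<psi>\<phi>: "\<psi> (\<phi> x) = x" if "x \<in> pm_support X" for x
    using bij that unfolding \<psi>_def bij_betw_def by (simp add: the_inv_into_f_f)
  have bij': "bij_betw \<psi> (pm_support Y) (pm_support X)"
    unfolding \<psi>_def by (rule bij_betw_the_inv_into[OF bij])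
  have iso': "pm_dist X (\<psi> y) (\<psi> y') = pm_dist Y y y'"
    if y: "y \<in> pm_support Y" and y': "y' \<in> pm_support Y" for y y'
  proof -
    obtain x x' where "x \<in> pm_support X" "y = \<phi> x" "x' \<in> pm_support X" "y' = \<phi> x'"
      using bij y y' by (metis bij_betw_def imageE)
    then show ?thesis using \<psi>\<phi> iso by auto
  qed
  have meas': "\<psi> \<in> ?MY \<rightarrow>\<^sub>M ?MX"
    by (rule pm_isometry_measurable[OF bij' iso'])
  have "distr ?MY ?MX \<psi> = distr (distr ?MX ?MY \<phi>) ?MX \<psi>"
    by (simp add: push)
  also have "\<dots> = distr ?MX ?MX (\<psi> \<circ> \<phi>)"
    by (rule distr_distr[OF meas' meas])
  also have "\<dots> = distr ?MX ?MX (\<lambda>x. x)"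
    by (rule distr_cong) (auto simp: space_restrict_space \<psi>\<phi>)
  also have "\<dots> = ?MX"
    by (simp add: distr_id2)
  finally show ?thesis
    using bij' iso' meas' unfolding pm_isomorphic_def pm_isomorphism_def by blast
qed

lemma pm_isomorphic_trans:
  assumes "pm_isomorphic X Y" "pm_isomorphic Y Z"
  shows "pm_isomorphic X Z"
proof -
  let ?MX = "restrict_space (pm_measure X) (pm_support X)"
  let ?MY = "restrict_space (pm_measure Y) (pm_support Y)"
  let ?MZ = "restrict_space (pm_measure Z) (pm_support Z)"
  obtain \<phi> \<psi> where \<phi>: "pm_isomorphism X Y \<phi>" and \<psi>: "pm_isomorphism Y Z \<psi>"
    using assms unfolding pm_isomorphic_def by blast
  have bij: "bij_betw \<phi> (pm_support X) (pm_support Y)"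
    using \<phi> unfolding pm_isomorphism_def by blast
  have m: "\<phi> \<in> ?MX \<rightarrow>\<^sub>M ?MY" "\<psi> \<in> ?MY \<rightarrow>\<^sub>M ?MZ"
    "distr ?MX ?MY \<phi> = ?MY" "distr ?MY ?MZ \<psi> = ?MZ"
    using \<phi> \<psi> unfolding pm_isomorphism_def by blast+
  have "distr ?MX ?MZ (\<psi> \<circ> \<phi>) = ?MZ"
    using distr_distr[OF m(2) m(1)] m by simp
  moreover have "bij_betw (\<psi> \<circ> \<phi>) (pm_support X) (pm_support Z)"
    using \<phi> \<psi> bij_betw_trans unfolding pm_isomorphism_def by blast
  moreover have "\<psi> \<circ> \<phi> \<in> ?MX \<rightarrow>\<^sub>M ?MZ"
    using m measurable_comp by blast
  moreover have "pm_dist Z ((\<psi> \<circ> \<phi>) x) ((\<psi> \<circ> \<phi>) x') = pm_dist X x x'"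
    if "x \<in> pm_support X" "x' \<in> pm_support X" for x x'
  proof -
    have "\<phi> x \<in> pm_support Y" "\<phi> x' \<in> pm_support Y"
      using bij that by (auto simp: bij_betw_def)
    then show ?thesis
      using \<phi> \<psi> that unfolding pm_isomorphism_def by simp
  qed
  ultimately show ?thesis
    unfolding pm_isomorphic_def pm_isomorphism_def by blast
qed

text \<open>
  A separable metric space has at most continuum many points, so every pm-space (on any type)
  is isomorphic to one whose set of points is a set of real numbers (with an unrelated metric).
  Hence the classes of type \<open>real pm_space\<close> are all the isomorphism classes of pm-spaces.
\<close>

quotient_type mm_class = "real pm_space" / pm_isomorphic
proof (rule equivpI)
  show "reflp (pm_isomorphic :: real pm_space \<Rightarrow> _)"
    by (rule reflpI) (rule pm_isomorphic_refl)
  show "symp (pm_isomorphic :: real pm_space \<Rightarrow> _)"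
    by (rule sympI) (rule pm_isomorphic_sym)
  show "transp (pm_isomorphic :: real pm_space \<Rightarrow> _)"
    by (rule transpI) (rule pm_isomorphic_trans)
qed

text \<open>
  Classes are represented by spaces of full support.  Such representatives are unique up to a
  measure-preserving isometry of the whole spaces, so which of them is used below is immaterial.
\<close>

definition represents :: "real pm_space \<Rightarrow> mm_class \<Rightarrow> bool" where
  "represents x X \<longleftrightarrow> abs_mm_class x = X \<and> pm_support x = pm_points x"

section \<open>Lipschitz order and box distance\<close>

definition pm_dominates :: "'a pm_space \<Rightarrow> 'b pm_space \<Rightarrow> bool" where
  "pm_dominates x y \<longleftrightarrow>
     (\<exists>\<phi> \<in> pm_measure x \<rightarrow>\<^sub>M pm_measure y.
        (\<forall>s\<in>pm_points x. \<forall>t\<in>pm_points x. pm_dist y (\<phi> s) (\<phi> t) \<le> pm_dist x s t) \<and>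
        distr (pm_measure x) (pm_measure y) \<phi> = pm_measure y)"

definition lip_le :: "mm_class \<Rightarrow> mm_class \<Rightarrow> bool"  (infix "\<preceq>\<^sub>L" 50) where
  "Y \<preceq>\<^sub>L X \<longleftrightarrow> (\<exists>x y. represents x X \<and> represents y Y \<and> pm_dominates x y)"

definition pm_parameter :: "'a pm_space \<Rightarrow> (real \<Rightarrow> 'a) \<Rightarrow> bool" where
  "pm_parameter x a \<longleftrightarrow>
     a \<in> restrict_space lborel {0..1} \<rightarrow>\<^sub>M pm_measure x \<and>
     distr (restrict_space lborel {0..1}) (pm_measure x) a = pm_measure x"

definition pm_box_close :: "real \<Rightarrow> 'a pm_space \<Rightarrow> 'b pm_space \<Rightarrow> bool" where
  "pm_box_close \<epsilon> x y \<longleftrightarrow>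
     (\<exists>a b I. pm_parameter x a \<and> pm_parameter y b \<and>
        I \<in> sets borel \<and> I \<subseteq> {0..1} \<and> measure lborel I \<ge> 1 - \<epsilon> \<and>
        (\<forall>s\<in>I. \<forall>t\<in>I. \<bar>pm_dist x (a s) (a t) - pm_dist y (b s) (b t)\<bar> \<le> \<epsilon>))"

definition box_dist :: "mm_class \<Rightarrow> mm_class \<Rightarrow> ennreal" where
  "box_dist X Y = Inf {ennreal \<epsilon> | \<epsilon>. \<epsilon> > 0 \<and>
     (\<exists>x y. represents x X \<and> represents y Y \<and> pm_box_close \<epsilon> x y)}"

definition box_topology :: "mm_class topology" where
  "box_topology = topology (\<lambda>U. \<forall>X\<in>U. \<exists>\<epsilon>>0. \<forall>Y. box_dist X Y < \<epsilon> \<longrightarrow> Y \<in> U)"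

lemma openin_box_topology:
  "openin box_topology U \<longleftrightarrow> (\<forall>X\<in>U. \<exists>\<epsilon>>0. \<forall>Y. box_dist X Y < \<epsilon> \<longrightarrow> Y \<in> U)"
proof -
  have "istopology (\<lambda>U. \<forall>X\<in>U. \<exists>\<epsilon>>0. \<forall>Y. box_dist X Y < \<epsilon> \<longrightarrow> Y \<in> U)"
    unfolding istopology_def
  proof (intro conjI allI impI ballI)
    fix S T X
    assume S: "\<forall>X\<in>S. \<exists>\<epsilon>>0. \<forall>Y. box_dist X Y < \<epsilon> \<longrightarrow> Y \<in> S"
      and T: "\<forall>X\<in>T. \<exists>\<epsilon>>0. \<forall>Y. box_dist X Y < \<epsilon> \<longrightarrow> Y \<in> T" and X: "X \<in> S \<inter> T"
    obtain e where "e > 0" "\<forall>Y. box_dist X Y < e \<longrightarrow> Y \<in> S"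
      using S X by blast
    moreover obtain e' where "e' > 0" "\<forall>Y. box_dist X Y < e' \<longrightarrow> Y \<in> T"
      using T X by blast
    ultimately show "\<exists>\<epsilon>>0. \<forall>Y. box_dist X Y < \<epsilon> \<longrightarrow> Y \<in> S \<inter> T"
      by (intro exI[of _ "min e e'"]) auto
  next
    fix K X
    assume "\<forall>S\<in>K. \<forall>X\<in>S. \<exists>\<epsilon>>0. \<forall>Y. box_dist X Y < \<epsilon> \<longrightarrow> Y \<in> S" "X \<in> \<Union>K"
    then show "\<exists>\<epsilon>>0. \<forall>Y. box_dist X Y < \<epsilon> \<longrightarrow> Y \<in> \<Union>K"
      by (meson Union_iff)
  qed
  then show ?thesis
    by (simp add: box_topology_def)
qed

lemma topspace_box_topology: "topspace box_topology = UNIV"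
proof -
  have "openin box_topology UNIV"
    unfolding openin_box_topology by (auto intro!: exI[of _ 1])
  then show ?thesis
    by (metis openin_subset top.extremum_uniqueI)
qed

section \<open>Pyramids and the weak topology\<close>

definition pyramids :: "mm_class set set" where
  "pyramids = {P. P \<noteq> {} \<and> closedin box_topology P \<and>
     (\<forall>X\<in>P. \<forall>Y. Y \<preceq>\<^sub>L X \<longrightarrow> Y \<in> P) \<and>
     (\<forall>X\<in>P. \<forall>Y\<in>P. \<exists>Z\<in>P. X \<preceq>\<^sub>L Z \<and> Y \<preceq>\<^sub>L Z)}"

definition pyramid_of :: "mm_class \<Rightarrow> mm_class set" where
  "pyramid_of X = {Y. Y \<preceq>\<^sub>L X}"

definition weakly_converges :: "(nat \<Rightarrow> mm_class set) \<Rightarrow> mm_class set \<Rightarrow> bool" where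
  "weakly_converges Ps P \<longleftrightarrow>
     (\<forall>X\<in>P. \<exists>Xs. (\<forall>n. Xs n \<in> Ps n) \<and> (\<lambda>n. box_dist (Xs n) X) \<longlonglongrightarrow> 0) \<and>
     (\<forall>X. X \<notin> P \<longrightarrow> liminf (\<lambda>n. INF Y\<in>Ps n. box_dist X Y) > 0)"

text \<open>
  The weak topology is the metrizable topology on the set of pyramids whose convergent sequences
  are the weakly convergent ones.  A metrizable topology is sequential, so its open sets are
  exactly the sequentially open ones.
\<close>

definition weak_topology :: "mm_class set topology" where
  "weak_topology = topology (\<lambda>U. U \<subseteq> pyramids \<and>
     (\<forall>Ps. \<forall>P\<in>U. (\<forall>n. Ps n \<in> pyramids) \<and> weakly_converges Ps P \<longrightarrow>
        (\<forall>\<^sub>F n in sequentially. Ps n \<in> U)))"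

lemma openin_weak_topology:
  "openin weak_topology U \<longleftrightarrow> U \<subseteq> pyramids \<and>
     (\<forall>Ps. \<forall>P\<in>U. (\<forall>n. Ps n \<in> pyramids) \<and> weakly_converges Ps P \<longrightarrow>
        (\<forall>\<^sub>F n in sequentially. Ps n \<in> U))"
proof -
  have "istopology (\<lambda>U. U \<subseteq> pyramids \<and>
     (\<forall>Ps. \<forall>P\<in>U. (\<forall>n. Ps n \<in> pyramids) \<and> weakly_converges Ps P \<longrightarrow>
        (\<forall>\<^sub>F n in sequentially. Ps n \<in> U)))" (is "istopology ?O")
    unfolding istopology_def
  proof (intro conjI allI impI ballI)
    fix S T assume "?O S" "?O T"
    then show "S \<inter> T \<subseteq> pyramids" by blast
  next
    fix S T Ps P assume ST: "?O S" "?O T"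
      and "P \<in> S \<inter> T" "(\<forall>n. Ps n \<in> pyramids) \<and> weakly_converges Ps P"
    then have "\<forall>\<^sub>F n in sequentially. Ps n \<in> S" "\<forall>\<^sub>F n in sequentially. Ps n \<in> T"
      by blast+
    then show "\<forall>\<^sub>F n in sequentially. Ps n \<in> S \<inter> T"
      by eventually_elim blast
  next
    fix K assume "\<forall>S\<in>K. ?O S"
    then show "\<Union>K \<subseteq> pyramids" by blast
  next
    fix K Ps P assume K: "\<forall>S\<in>K. ?O S" and "P \<in> \<Union>K"
      and c: "(\<forall>n. Ps n \<in> pyramids) \<and> weakly_converges Ps P"
    then obtain S where S: "S \<in> K" "P \<in> S" by blast
    then have "\<forall>\<^sub>F n in sequentially. Ps n \<in> S"
      using K c by blast
    then show "\<forall>\<^sub>F n in sequentially. Ps n \<in> \<Union>K"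
      by (rule eventually_mono) (use S in blast)
  qed
  then show ?thesis
    by (simp add: weak_topology_def)
qed

lemma topspace_weak_topology: "topspace weak_topology = pyramids"
proof (rule equalityI)
  show "topspace weak_topology \<subseteq> pyramids"
    using openin_topspace[of weak_topology] unfolding openin_weak_topology by blast
  have "openin weak_topology pyramids"
    unfolding openin_weak_topology by auto
  then show "pyramids \<subseteq> topspace weak_topology"
    by (rule openin_subset)
qed

section \<open>Lower semicontinuity\<close>

definition lower_semicontinuous :: "'a topology \<Rightarrow> ('a \<Rightarrow> ennreal) \<Rightarrow> bool" where
  "lower_semicontinuous T f \<longleftrightarrow> (\<forall>c. openin T {x \<in> topspace T. c < f x})"

end

(*
  Monotonicity applied to the pyramids of the spaces X in P, all contained in P, gives
  sup F <= G(P).  For the converse it suffices to exhaust P by pyramids of single spaces: the box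
  topology is separable, so P has a countable dense subset, and directedness yields spaces
  Z_n in P with Z_n dominating the first n of its elements.  Their pyramids converge weakly to P,
  and lower semicontinuity gives G(P) <= liminf F(Z_n).

  That the pyramid of X is box-closed is a compactness argument: if Y_n is dominated by X and
  converges to Z, the composites of X -> Y_n with the almost isometries between Y_n and Z are almost
  1-Lipschitz and almost measure-preserving, and a diagonal subsequence converges pointwise to a
  1-Lipschitz map X -> Z.  It preserves the measure because two Borel probability measures coincide
  as soon as one is at most the other on closed sets.
*)

theory Submission
  imports Defs "HOL-Library.Diagonal_Subsequence"
begin

section \<open>Borel probability measures on metric spaces\<close>

text \<open>Monotonicity of \<open>G\<close> and openness in \<open>weak_topology\<close> only
  concern members of \<open>pyramids\<close>, so neither can be applied to
  \<open>pyramid_of X\<close> before that set is known to be box-closed. This is where most of the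
  work lies. Neither space need be compact, so equicontinuity alone yields no limit map; the missing
  precompactness comes from the measures. In a space of full support every ball has positive mass,
  while finitely many small balls of the target carry almost all of its mass, so one fixed finite
  family of balls always catches images of points near a given point. Hence the care taken over
  representatives of full support. The second obstacle is that \<open>box_dist\<close> is an infimum
  over parameters: an upper bound requires a parameter to begin with. Separability rests on such
  bounds, and therefore every pm-space must first be shown to have a parameter, by passing through
  the real line and a quantile function. The pyramids of the \<open>Z n\<close> need not exhaust
  \<open>P\<close> as sets. Weak convergence only asks that they approximate each element of
  \<open>P\<close> in the box distance.\<close>

lemma prob_space_pm_measure: "prob_space (pm_measure X)"
  using is_pm_space[of X] by (simp add: is_pm_space_def)

lemma closedin_pm_compl:
  "openin (mtopology_of (pm_metric X)) U \<Longrightarrow> closedin (mtopology_of (pm_metric X)) (pm_points X - U)"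
  using closedin_diff[OF closedin_topspace, of "mtopology_of (pm_metric X)" U] by simp

lemma openin_pm_measurable:
  "openin (mtopology_of (pm_metric X)) U \<Longrightarrow> U \<in> sets (pm_measure X)"
  by (simp add: sets_pm_measure)

lemma closedin_pm_measurable:
  assumes "closedin (mtopology_of (pm_metric X)) C"
  shows "C \<in> sets (pm_measure X)"
proof -
  have "space (pm_measure X) - (pm_points X - C) \<in> sets (pm_measure X)"
    using assms by (intro sets.compl_sets openin_pm_measurable) (auto simp: closedin_def)
  moreover have "space (pm_measure X) - (pm_points X - C) = C"
    using closedin_subset[OF assms] by (auto simp: space_pm_measure)
  ultimately show ?thesis by simp
qed

lemma measurable_pm_measureI:
  assumes "f \<in> space M \<rightarrow> pm_points X"
    and "\<And>C. closedin (mtopology_of (pm_metric X)) C \<Longrightarrow> f -` C \<inter> space M \<in> sets M"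
  shows "f \<in> M \<rightarrow>\<^sub>M pm_measure X"
proof (rule measurable_sigma_sets[OF sets_pm_measure])
  show "{U. openin (mtopology_of (pm_metric X)) U} \<subseteq> Pow (pm_points X)"
    using openin_subset by fastforce
  show "f \<in> space M \<rightarrow> pm_points X" by fact
  fix U assume "U \<in> {U. openin (mtopology_of (pm_metric X)) U}"
  then have "closedin (mtopology_of (pm_metric X)) (pm_points X - U)"
    by (simp add: closedin_pm_compl)
  then have "space M - (f -` (pm_points X - U) \<inter> space M) \<in> sets M"
    using assms(2) by blast
  moreover have "space M - (f -` (pm_points X - U) \<inter> space M) = f -` U \<inter> space M"
    using assms(1) by auto
  ultimately show "f -` U \<inter> space M \<in> sets M"
    by simp
qed

text \<open>Both measures have mass one, so passing to complements turns the bound on closed sets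
  into the opposite bound on open sets. Conversely, an open set of a metric space is an increasing
  union of closed sets, so the bound itself passes to open sets. These form an intersection-stable
  generator.\<close>

lemma pm_measure_eqI:
  assumes "prob_space M" and sets: "sets M = sets (pm_measure X)"
    and le: "\<And>C. closedin (mtopology_of (pm_metric X)) C \<Longrightarrow>
      measure (pm_measure X) C \<le> measure M C"
  shows "M = pm_measure X"
proof -
  interpret M: prob_space M by fact
  interpret X: prob_space "pm_measure X" by (rule prob_space_pm_measure)
  interpret MX: Metric_space "pm_points X" "pm_dist X" by simp
  have space: "space M = pm_points X" "space (pm_measure X) = pm_points X"
    using sets_eq_imp_space_eq[OF sets] by (simp_all add: space_pm_measure)
  have "emeasure M U = emeasure (pm_measure X) U" if U: "openin (mtopology_of (pm_metric X)) U" for U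
  proof -
    have Um: "U \<in> sets (pm_measure X)" "U \<in> sets M"
      using U sets by (auto intro: openin_pm_measurable)
    have "measure (pm_measure X) (pm_points X - U) \<le> measure M (pm_points X - U)"
      using U by (intro le closedin_pm_compl)
    then have 1: "measure M U \<le> measure (pm_measure X) U"
      using M.prob_compl[of U] X.prob_compl[of U] Um space by simp
    have "fsigma_in MX.mtopology U"
      using U by (intro open_imp_fsigma_in MX.metrizable_space_mtopology) (simp add: mtopology_of_def)
    then obtain C where C: "\<And>n::nat. closedin MX.mtopology (C n)" "\<And>n. C n \<subseteq> C (Suc n)"
        "\<Union>(range C) = U"
      unfolding fsigma_in_ascending by blast
    have Cm: "range C \<subseteq> sets (pm_measure X)"
      using C(1) closedin_pm_measurable[of X] by (auto simp: mtopology_of_def)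
    have "(\<lambda>n. measure (pm_measure X) (C n)) \<longlonglongrightarrow> measure (pm_measure X) (\<Union>(range C))"
      using C Cm by (intro X.finite_Lim_measure_incseq) (auto simp: incseq_Suc_iff)
    moreover have "measure (pm_measure X) (C n) \<le> measure M U" for n
    proof -
      have "measure (pm_measure X) (C n) \<le> measure M (C n)"
        using C by (intro le) (auto simp: mtopology_of_def)
      also have "\<dots> \<le> measure M U"
        using C Um by (intro M.finite_measure_mono) auto
      finally show ?thesis .
    qed
    ultimately have "measure (pm_measure X) U \<le> measure M U"
      using C by (metis LIMSEQ_le_const2)
    then show ?thesis
      using 1 by (simp add: M.emeasure_eq_measure X.emeasure_eq_measure)
  qed
  then show ?thesis
    by (intro measure_eqI_generator_eq[where E="{U. openin (mtopology_of (pm_metric X)) U}"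
         and \<Omega>="pm_points X" and A="\<lambda>_. pm_points X"])
      (use openin_subset[of "mtopology_of (pm_metric X)"] openin_topspace[of "mtopology_of (pm_metric X)"] in \<open>auto simp: Int_stable_def sets sets_pm_measure\<close>)
qed

lemma pm_dense_sequence:
  obtains z :: "nat \<Rightarrow> 'a" where "\<And>n. z n \<in> pm_points X"
    "\<And>x e. x \<in> pm_points X \<Longrightarrow> e > 0 \<Longrightarrow> \<exists>n. pm_dist X x (z n) < e"
proof -
  interpret MX: Metric_space "pm_points X" "pm_dist X" by simp
  interpret X: prob_space "pm_measure X" by (rule prob_space_pm_measure)
  obtain D where D: "countable D" "D \<subseteq> pm_points X" "MX.mtopology closure_of D = pm_points X"
    using is_pm_space[of X] unfolding is_pm_space_def separable_space_def
    by (auto simp: mtopology_of_def)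
  \<comment> \<open>\<open>from_nat_into\<close> enumerates only non-empty sets; a probability space
    has a point.\<close>
  have "pm_points X \<noteq> {}"
    using X.not_empty by (simp add: space_pm_measure)
  then have "D \<noteq> {}"
    using D by auto
  then have r: "range (from_nat_into D) = D"
    using D by (simp add: range_from_nat_into)
  show ?thesis
  proof (rule that[of "from_nat_into D"])
    show "from_nat_into D n \<in> pm_points X" for n
      using r D by auto
    fix x e assume x: "x \<in> pm_points X" and "e > (0::real)"
    then obtain y where "y \<in> D" "y \<in> MX.mball x e"
      using D(3) unfolding MX.metric_closure_of by blast
    then show "\<exists>n. pm_dist X x (from_nat_into D n) < e"
      using r by (metis MX.in_mball imageE)
  qed
qed

text \<open>Sequential compactness of the space of 0-1 sequences. To decide \<open>P j\<close>, pass
  to the indices where it holds if there are infinitely many; otherwise it already fails eventually.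
  Being decided survives passage to subsequences, so one diagonal sequence serves all
  \<open>j\<close>.\<close>

lemma ex_subseq_eventually_decided:
  fixes P :: "nat \<Rightarrow> nat \<Rightarrow> bool"
  obtains r :: "nat \<Rightarrow> nat" where "strict_mono r"
    "\<And>j. (\<forall>\<^sub>F n in sequentially. P j (r n)) \<or> (\<forall>\<^sub>F n in sequentially. \<not> P j (r n))"
proof -
  define Q where "Q j s \<longleftrightarrow> (\<forall>\<^sub>F n in sequentially. P j (s n)) \<or> (\<forall>\<^sub>F n in sequentially. \<not> P j (s n))"
    for j and s :: "nat \<Rightarrow> nat"
  have Q_subseq: "Q j (s \<circ> r)" if "strict_mono r" "Q j s" for j s and r :: "nat \<Rightarrow> nat"
    using that eventually_subseq[of r] unfolding Q_def by auto
  interpret subseqs Q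
  proof
    fix j and s :: "nat \<Rightarrow> nat"
    show "\<exists>r'. strict_mono r' \<and> Q j (s \<circ> r')"
    proof (cases "infinite {n. P j (s n)}")
      case True
      then obtain r :: "nat \<Rightarrow> nat" where "strict_mono r" "\<And>n. r n \<in> {n. P j (s n)}"
        using infinite_enumerate by blast
      then show ?thesis
        by (intro exI[of _ r]) (simp add: Q_def)
    next
      case False
      then have "\<forall>\<^sub>F n in sequentially. \<not> P j (s n)"
        by (simp add: eventually_cofinite flip: cofinite_eq_sequentially)
      then show ?thesis
        by (intro exI[of _ id]) (auto simp: Q_def strict_mono_def)
    qed
  qed
  show ?thesis
  proof (rule that[OF subseq_diagseq])
    fix j
    \<comment> \<open>Only the tail of the diagonal sequence is a subsequence of stage
      \<open>j\<close>; the dropped \<open>Suc j\<close> terms do not affect what holds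
      eventually.\<close>
    have "Q j (diagseq \<circ> (+) (Suc j))"
      by (rule diagseq_holds) (rule Q_subseq)
    then show "(\<forall>\<^sub>F n in sequentially. P j (diagseq n)) \<or> (\<forall>\<^sub>F n in sequentially. \<not> P j (diagseq n))"
      unfolding Q_def[of j] o_def
      using eventually_sequentially_seg[of "\<lambda>n. P j (diagseq n)" "Suc j"]
        eventually_sequentially_seg[of "\<lambda>n. \<not> P j (diagseq n)" "Suc j"]
      by (simp add: add.commute)
  qed
qed

section \<open>Full-support representatives and the Lipschitz order\<close>

text \<open>Unlike separability, second countability passes to every subspace, in particular to the
  support. A countable base also reduces a union of arbitrarily many null open sets to a countable
  one.\<close>

lemma second_countable_pm_metric:
  fixes X :: "'a pm_space"
  shows "second_countable (mtopology_of (pm_metric X))"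
proof -
  interpret MX: Metric_space "pm_points X" "pm_dist X" by simp
  obtain z :: "nat \<Rightarrow> 'a" where z: "\<And>n. z n \<in> pm_points X"
    "\<And>x e. x \<in> pm_points X \<Longrightarrow> e > 0 \<Longrightarrow> \<exists>n. pm_dist X x (z n) < e"
    by (rule pm_dense_sequence[of X]) blast
  define B where "B = (\<lambda>(n, k). MX.mball (z n) (1 / Suc k)) ` (UNIV :: (nat \<times> nat) set)"
  have "\<exists>V\<in>B. x \<in> V \<and> V \<subseteq> U" if U: "openin MX.mtopology U" and xU: "x \<in> U" for U x
  proof -
    have x: "x \<in> pm_points X"
      using openin_subset[OF U] xU by auto
    obtain r where r: "r > 0" "MX.mball x r \<subseteq> U"
      using U xU unfolding MX.openin_mtopology by auto
    obtain k where k: "1 / Suc k < r / 2"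
      using reals_Archimedean[of "r / 2"] r by (auto simp: inverse_eq_divide)
    have "0 < 1 / real (Suc k)"
      by simp
    from z(2)[OF x this] obtain n where n: "pm_dist X x (z n) < 1 / Suc k" ..
    have "MX.mball (z n) (1 / Suc k) \<subseteq> MX.mball x r"
    proof
      fix y assume "y \<in> MX.mball (z n) (1 / Suc k)"
      then have "y \<in> pm_points X" "pm_dist X (z n) y < 1 / Suc k" by simp_all
      then show "y \<in> MX.mball x r"
        using MX.triangle[of x "z n" y] x z(1)[of n] n k by simp
    qed
    moreover have "x \<in> MX.mball (z n) (1 / Suc k)"
      using n x z(1) by (simp add: MX.commute[of x])
    ultimately show ?thesis
      using r unfolding B_def by (intro bexI[of _ "MX.mball (z n) (1 / Suc k)"]) auto
  qed
  then show ?thesis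
    unfolding second_countable_def mtopology_of_def
    by (intro exI[of _ B] conjI) (simp_all add: B_def split_beta)
qed

lemma closedin_pm_support: "closedin (mtopology_of (pm_metric X)) (pm_support X)"
proof -
  define N where "N = \<Union>{U. openin (mtopology_of (pm_metric X)) U \<and> emeasure (pm_measure X) U = 0}"
  have "openin (mtopology_of (pm_metric X)) N"
    unfolding N_def by (rule openin_Union) auto
  moreover have "pm_support X = pm_points X - N"
    by (auto simp: pm_support_def N_def zero_less_iff_neq_zero)
  ultimately show ?thesis
    by (simp add: closedin_pm_compl)
qed

text \<open>The complement of the support is a union of possibly uncountably many null open sets,
  but each of its points lies in a null member of a countable base.\<close>

lemma emeasure_pm_support: "emeasure (pm_measure X) (pm_support X) = 1"
proof -
  interpret X: prob_space "pm_measure X" by (rule prob_space_pm_measure)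
  obtain B where B: "countable B" "\<forall>V\<in>B. openin (mtopology_of (pm_metric X)) V"
    "\<forall>U x. openin (mtopology_of (pm_metric X)) U \<and> x \<in> U \<longrightarrow> (\<exists>V\<in>B. x \<in> V \<and> V \<subseteq> U)"
    using second_countable_pm_metric[of X] unfolding second_countable_def by blast
  define C where "C = {V \<in> B. emeasure (pm_measure X) V = 0}"
  have C: "countable C" "\<And>V. V \<in> C \<Longrightarrow> V \<in> null_sets (pm_measure X)"
    using B(1,2) openin_pm_measurable[of X] unfolding C_def
    by (auto intro: countable_subset[of _ B] null_setsI)
  have "\<Union>C \<in> null_sets (pm_measure X)"
    using null_sets_UN'[OF C(1), of "\<lambda>V. V"] C(2) by simp
  moreover have "space (pm_measure X) - pm_support X \<subseteq> \<Union>C"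
  proof
    fix x assume "x \<in> space (pm_measure X) - pm_support X"
    then obtain U where U: "openin (mtopology_of (pm_metric X)) U" "x \<in> U"
        "emeasure (pm_measure X) U = 0"
      by (auto simp: pm_support_def space_pm_measure zero_less_iff_neq_zero)
    then obtain V where "V \<in> B" "x \<in> V" "V \<subseteq> U"
      using B by blast
    then show "x \<in> \<Union>C"
      using U emeasure_mono[of V U "pm_measure X"] openin_pm_measurable[of X U]
      by (auto simp: C_def)
  qed
  moreover have S: "pm_support X \<in> sets (pm_measure X)"
    by (intro closedin_pm_measurable closedin_pm_support)
  ultimately have "emeasure (pm_measure X) (space (pm_measure X) - pm_support X) = 0"
    by (meson null_setsD1 null_sets_subset sets.compl_sets)
  then have "X.prob (space (pm_measure X) - pm_support X) = 0"
    by (simp add: measure_def)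
  then show ?thesis
    using X.prob_compl[OF S] by (simp add: X.emeasure_eq_measure)
qed

lemma restrict_space_space: "restrict_space M (space M) = M"
proof (rule measure_eqI)
  have "(\<lambda>A. space M \<inter> A) ` sets M = (\<lambda>A. A) ` sets M"
    by (rule image_cong) (use sets.sets_into_space in auto)
  then show *: "sets (restrict_space M (space M)) = sets M"
    by (simp add: sets_restrict_space)
  show "emeasure (restrict_space M (space M)) A = emeasure M A"
    if "A \<in> sets (restrict_space M (space M))" for A
    using that sets.sets_into_space[of A M] unfolding * by (intro emeasure_restrict_space) auto
qed

text \<open>The support itself, with the induced metric and measure, is the representative: it is
  complete because closed, has total mass one, and the identity of the support is an
  isomorphism.\<close>

lemma ex_represents: "\<exists>x. represents x X"
proof (induction X rule: mm_class.abs_induct)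
  case (1 x)
  define S where "S = pm_support x"
  define m where "m = restrict_space (pm_measure x) S"
  define d where "d = submetric (pm_metric x) S"
  have S: "S \<subseteq> pm_points x" "closedin (mtopology_of (pm_metric x)) S" "S \<in> sets (pm_measure x)"
    "emeasure (pm_measure x) S = 1"
    unfolding S_def by (rule pm_support_subset closedin_pm_support emeasure_pm_support
      closedin_pm_measurable[OF closedin_pm_support])+
  interpret P: prob_space "pm_measure x" by (rule prob_space_pm_measure)
  interpret MX: Submetric "pm_points x" "pm_dist x" S
    using S(1) by (simp add: Submetric_def Submetric_axioms_def)
  have sp: "mspace d = S"
    using S by (auto simp: d_def)
  have top: "mtopology_of d = subtopology (mtopology_of (pm_metric x)) S"
    by (simp add: d_def mtopology_of_submetric)
  have "mcomplete_of d"
    using MX.closedin_mcomplete_imp_mcomplete S is_pm_space[of x]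
    by (simp add: mcomplete_of_def sp is_pm_space_def mtopology_of_def) (simp add: d_def)
  moreover have "separable_space (mtopology_of d)"
    unfolding top
    by (intro second_countable_imp_separable_space second_countable_subtopology second_countable_pm_metric)
  moreover have spm: "space m = S"
    using S by (auto simp: m_def space_restrict_space space_pm_measure)
  moreover have "sets m = sigma_sets (mspace d) {U. openin (mtopology_of d) U}"
  proof -
    have "sets m = (\<inter>) S ` sigma_sets (pm_points x) {U. openin (mtopology_of (pm_metric x)) U}"
      unfolding m_def sets_restrict_space sets_pm_measure ..
    also have "\<dots> = sigma_sets S ((\<inter>) S ` {U. openin (mtopology_of (pm_metric x)) U})"
      using S by (intro sigma_sets_Int) (auto simp: sets_pm_measure)
    also have "(\<inter>) S ` {U. openin (mtopology_of (pm_metric x)) U} = {U. openin (mtopology_of d) U}"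
      unfolding top openin_subtopology by auto
    finally show ?thesis by (simp add: sp)
  qed
  moreover have "prob_space m"
    unfolding m_def by (rule prob_space_restrict_space) (use S in auto)
  ultimately have pm: "is_pm_space d m"
    by (simp add: is_pm_space_def sp)
  define y where "y = Abs_pm_space (d, m)"
  have y: "pm_metric y = d" "pm_measure y = m"
    using pm by (simp_all add: y_def pm_metric_def pm_measure_def Abs_pm_space_inverse)
  have supp: "pm_support y = S"
  proof
    show "pm_support y \<subseteq> S"
      using pm_support_subset[of y] by (simp add: y sp)
    show "S \<subseteq> pm_support y"
    proof
      fix p assume p: "p \<in> S"
      have "emeasure m U > 0" if U: "openin (mtopology_of d) U" "p \<in> U" for U
      proof -
        obtain V where V: "openin (mtopology_of (pm_metric x)) V" "U = V \<inter> S"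
          using U unfolding top openin_subtopology by blast
        have "emeasure (pm_measure x) V > 0"
          using p V U unfolding S_def pm_support_def by auto
        \<comment> \<open>Cutting \<open>V\<close> down to \<open>S\<close> removes only a null set,
          so relatively open sets inherit positive mass.\<close>
        also have "emeasure (pm_measure x) V = emeasure (pm_measure x) (V \<inter> S)"
          using P.measure_space_inter[OF openin_pm_measurable[OF V(1)] S(3)] S(4)
          unfolding P.emeasure_eq_measure P.prob_space by simp
        also have "\<dots> = emeasure m U"
          unfolding m_def V by (subst emeasure_restrict_space) (use S in auto)
        finally show ?thesis .
      qed
      then show "p \<in> pm_support y"
        using p unfolding pm_support_def y sp by blast
    qed
  qed
  have mS: "restrict_space m S = m"
    using restrict_space_space[of m] by (simp add: spm)
  have "distr m m (\<lambda>p. p) = m"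
    by (rule distr_id2) simp
  then have "pm_isomorphism x y (\<lambda>p. p)"
    unfolding pm_isomorphism_def supp y S_def[symmetric] mS m_def[symmetric]
    by (simp add: bij_betw_def d_def)
  then have "pm_isomorphic x y"
    unfolding pm_isomorphic_def by blast
  then have "abs_mm_class y = abs_mm_class x"
    by (simp add: mm_class.abs_eq_iff pm_isomorphic_sym)
  then show ?case
    by (intro exI[of _ y]) (simp add: represents_def supp y sp)
qed

lemma restrict_space_pm_points: "restrict_space (pm_measure x) (pm_points x) = pm_measure x"
  using restrict_space_space[of "pm_measure x"] by (simp add: space_pm_measure)

text \<open>Full support removes the restrictions in \<open>pm_isomorphism\<close>, leaving a map
  between the whole spaces that can be composed with 1-Lipschitz maps and with parameters.\<close>

lemma represents_isometry:
  assumes "represents x X" "represents x' X"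
  obtains \<phi> where "\<phi> \<in> pm_measure x \<rightarrow>\<^sub>M pm_measure x'"
    "distr (pm_measure x) (pm_measure x') \<phi> = pm_measure x'"
    "\<And>s t. s \<in> pm_points x \<Longrightarrow> t \<in> pm_points x \<Longrightarrow> pm_dist x' (\<phi> s) (\<phi> t) = pm_dist x s t"
proof -
  have "pm_isomorphic x x'"
    using assms by (metis mm_class.abs_eq_iff represents_def)
  then obtain \<phi> where \<phi>: "pm_isomorphism x x' \<phi>"
    unfolding pm_isomorphic_def ..
  have supp: "pm_support x = pm_points x" "pm_support x' = pm_points x'"
    using assms by (simp_all add: represents_def)
  show ?thesis
    by (rule that[of \<phi>])
      (use \<phi> in \<open>simp_all add: pm_isomorphism_def supp restrict_space_pm_points\<close>)
qed

lemma pm_dominates_trans: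
  assumes "pm_dominates x y" "pm_dominates y z"
  shows "pm_dominates x z"
proof -
  obtain \<phi> where \<phi>: "\<phi> \<in> pm_measure x \<rightarrow>\<^sub>M pm_measure y"
    "\<And>s t. s \<in> pm_points x \<Longrightarrow> t \<in> pm_points x \<Longrightarrow> pm_dist y (\<phi> s) (\<phi> t) \<le> pm_dist x s t"
    "distr (pm_measure x) (pm_measure y) \<phi> = pm_measure y"
    using assms(1) unfolding pm_dominates_def by blast
  obtain \<psi> where \<psi>: "\<psi> \<in> pm_measure y \<rightarrow>\<^sub>M pm_measure z"
    "\<And>s t. s \<in> pm_points y \<Longrightarrow> t \<in> pm_points y \<Longrightarrow> pm_dist z (\<psi> s) (\<psi> t) \<le> pm_dist y s t"
    "distr (pm_measure y) (pm_measure z) \<psi> = pm_measure z"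
    using assms(2) unfolding pm_dominates_def by blast
  have "\<phi> s \<in> pm_points y" if "s \<in> pm_points x" for s
    using measurable_space[OF \<phi>(1)] that by (simp add: space_pm_measure)
  then have "pm_dist z ((\<psi> \<circ> \<phi>) s) ((\<psi> \<circ> \<phi>) t) \<le> pm_dist x s t"
    if "s \<in> pm_points x" "t \<in> pm_points x" for s t
    using that \<phi>(2)[of s t] \<psi>(2)[of "\<phi> s" "\<phi> t"] by force
  moreover have "distr (pm_measure x) (pm_measure z) (\<psi> \<circ> \<phi>) = pm_measure z"
    using distr_distr[OF \<psi>(1) \<phi>(1)] \<phi>(3) \<psi>(3) by simp
  moreover have "\<psi> \<circ> \<phi> \<in> pm_measure x \<rightarrow>\<^sub>M pm_measure z"
    using \<phi>(1) \<psi>(1) by (rule measurable_comp)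
  ultimately show ?thesis
    unfolding pm_dominates_def by blast
qed

lemma represents_dominates:
  assumes "represents x X" "represents x' X"
  shows "pm_dominates x x'"
proof -
  obtain \<phi> where "\<phi> \<in> pm_measure x \<rightarrow>\<^sub>M pm_measure x'"
    "distr (pm_measure x) (pm_measure x') \<phi> = pm_measure x'"
    "\<And>s t. s \<in> pm_points x \<Longrightarrow> t \<in> pm_points x \<Longrightarrow> pm_dist x' (\<phi> s) (\<phi> t) = pm_dist x s t"
    by (rule represents_isometry[OF assms]) blast
  then show ?thesis
    unfolding pm_dominates_def by (intro bexI[of _ \<phi>]) auto
qed

text \<open>Two representatives of a class dominate each other, so composing on both sides turns the
  existential choice in \<open>lip_le\<close> into an arbitrary one.\<close>

lemma lip_le_iff_dominates:
  assumes "represents x X" "represents y Y"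
  shows "Y \<preceq>\<^sub>L X \<longleftrightarrow> pm_dominates x y"
proof
  assume "Y \<preceq>\<^sub>L X"
  then obtain x' y' where "represents x' X" "represents y' Y" "pm_dominates x' y'"
    unfolding lip_le_def by blast
  then show "pm_dominates x y"
    using represents_dominates assms pm_dominates_trans by metis
qed (use assms in \<open>auto simp: lip_le_def\<close>)

lemma lip_le_refl: "X \<preceq>\<^sub>L X"
proof -
  obtain x where "represents x X"
    using ex_represents ..
  then show ?thesis
    using lip_le_iff_dominates represents_dominates by metis
qed

lemma lip_le_trans:
  assumes "X \<preceq>\<^sub>L Y" "Y \<preceq>\<^sub>L Z"
  shows "X \<preceq>\<^sub>L Z"
proof -
  obtain x y z where xyz: "represents x X" "represents y Y" "represents z Z"
    using ex_represents by metis
  then have "pm_dominates y x" "pm_dominates z y"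
    using assms lip_le_iff_dominates by auto
  then have "pm_dominates z x"
    using pm_dominates_trans by metis
  then show ?thesis
    using xyz lip_le_iff_dominates by auto
qed

section \<open>Parameters and the box distance on fixed representatives\<close>

lemma pm_parameter_comp:
  assumes "pm_parameter x a" "\<phi> \<in> pm_measure x \<rightarrow>\<^sub>M pm_measure y"
    "distr (pm_measure x) (pm_measure y) \<phi> = pm_measure y"
  shows "pm_parameter y (\<phi> \<circ> a)"
  using assms distr_distr[OF assms(2), of a "restrict_space lborel {0..1}"]
  unfolding pm_parameter_def by (auto intro: measurable_comp)

lemma pm_parameter_in_points: "pm_parameter x a \<Longrightarrow> s \<in> {0..1} \<Longrightarrow> a s \<in> pm_points x"
  using measurable_space[of a "restrict_space lborel {0..1}" "pm_measure x" s]
  by (auto simp: pm_parameter_def space_pm_measure space_restrict_space)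

text \<open>Parameters are transported along the isometries between representatives; the distances
  compared and the set \<open>I\<close> stay the same.\<close>

lemma pm_box_close_represents:
  assumes "represents x X" "represents x' X" "represents y Y" "represents y' Y"
    and "pm_box_close \<epsilon> x y"
  shows "pm_box_close \<epsilon> x' y'"
proof -
  obtain a b I where ab: "pm_parameter x a" "pm_parameter y b"
    and I: "I \<in> sets borel" "I \<subseteq> {0..1}" "measure lborel I \<ge> 1 - \<epsilon>"
    and close: "\<And>s t. s \<in> I \<Longrightarrow> t \<in> I \<Longrightarrow> \<bar>pm_dist x (a s) (a t) - pm_dist y (b s) (b t)\<bar> \<le> \<epsilon>"
    using assms(5) unfolding pm_box_close_def by blast
  obtain \<phi> where \<phi>: "\<phi> \<in> pm_measure x \<rightarrow>\<^sub>M pm_measure x'"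
    "distr (pm_measure x) (pm_measure x') \<phi> = pm_measure x'"
    "\<And>s t. s \<in> pm_points x \<Longrightarrow> t \<in> pm_points x \<Longrightarrow> pm_dist x' (\<phi> s) (\<phi> t) = pm_dist x s t"
    by (rule represents_isometry[OF assms(1,2)]) blast
  obtain \<psi> where \<psi>: "\<psi> \<in> pm_measure y \<rightarrow>\<^sub>M pm_measure y'"
    "distr (pm_measure y) (pm_measure y') \<psi> = pm_measure y'"
    "\<And>s t. s \<in> pm_points y \<Longrightarrow> t \<in> pm_points y \<Longrightarrow> pm_dist y' (\<psi> s) (\<psi> t) = pm_dist y s t"
    by (rule represents_isometry[OF assms(3,4)]) blast
  have "\<bar>pm_dist x' ((\<phi> \<circ> a) s) ((\<phi> \<circ> a) t) - pm_dist y' ((\<psi> \<circ> b) s) ((\<psi> \<circ> b) t)\<bar> \<le> \<epsilon>"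
    if "s \<in> I" "t \<in> I" for s t
  proof -
    have "s \<in> {0..1}" "t \<in> {0..1}" using that I by blast+
    then show ?thesis
      using close[OF that] ab by (simp add: \<phi>(3) \<psi>(3) pm_parameter_in_points)
  qed
  then show ?thesis
    unfolding pm_box_close_def
    using pm_parameter_comp[OF ab(1) \<phi>(1,2)] pm_parameter_comp[OF ab(2) \<psi>(1,2)] I by blast
qed

lemma box_dist_lessD:
  assumes "box_dist X Y < e" "represents x X" "represents y Y"
  obtains \<epsilon> where "\<epsilon> > 0" "ennreal \<epsilon> < e" "pm_box_close \<epsilon> x y"
proof -
  obtain \<epsilon> x' y' where \<epsilon>: "\<epsilon> > 0" "ennreal \<epsilon> < e" and
    "represents x' X" "represents y' Y" "pm_box_close \<epsilon> x' y'"
    using assms(1) unfolding box_dist_def Inf_less_iff by blast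
  then have "pm_box_close \<epsilon> x y"
    using pm_box_close_represents assms(2,3) by metis
  with \<epsilon> show ?thesis by (rule that)
qed

lemma box_dist_le:
  assumes "represents x X" "represents y Y" "\<epsilon> > 0" "pm_box_close \<epsilon> x y"
  shows "box_dist X Y \<le> ennreal \<epsilon>"
  unfolding box_dist_def using assms by (intro Inf_lower) blast

section \<open>Closedness of the pyramid of a space\<close>

text \<open>
  The relations \<open>S n\<close> play the role of almost \<open>1\<close>-Lipschitz, almost measure-preserving maps from
  \<open>x\<close> to \<open>z\<close>; working with relations avoids any measurable selection.  The assumption \<open>decided\<close>
  is achieved by a diagonal subsequence and replaces a compactness argument for the maps.
\<close>

locale almost_lipschitz_relations =
  fixes x :: "'a pm_space" and z :: "'b pm_space"
    and S :: "nat \<Rightarrow> ('a \<times> 'b) set" and \<delta> :: "nat \<Rightarrow> real"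
    and u :: "nat \<Rightarrow> 'a" and v :: "nat \<Rightarrow> 'b"
  assumes full_support: "pm_support x = pm_points x"
    and error_tendsto: "\<delta> \<longlonglongrightarrow> 0"
    and in_points: "\<And>n p q. (p, q) \<in> S n \<Longrightarrow> p \<in> pm_points x \<and> q \<in> pm_points z"
    and lipschitz: "\<And>n p q p' q'. (p, q) \<in> S n \<Longrightarrow> (p', q') \<in> S n \<Longrightarrow>
      pm_dist z q q' \<le> pm_dist x p p' + \<delta> n"
    and measure_le: "\<And>n C. C \<in> sets (pm_measure z) \<Longrightarrow>
      \<exists>A\<in>sets (pm_measure x). (\<forall>p\<in>A. \<exists>q\<in>C. (p, q) \<in> S n) \<and>
        measure (pm_measure z) C \<le> measure (pm_measure x) A + \<delta> n"
    and u_points: "\<And>k. u k \<in> pm_points x"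
    and u_dense: "\<And>p e. p \<in> pm_points x \<Longrightarrow> e > 0 \<Longrightarrow> \<exists>k. pm_dist x p (u k) < e"
    and v_points: "\<And>l. v l \<in> pm_points z"
    and v_dense: "\<And>q e. q \<in> pm_points z \<Longrightarrow> e > 0 \<Longrightarrow> \<exists>l. pm_dist z q (v l) < e"
    and decided: "\<And>k i l.
      (\<forall>\<^sub>F n in sequentially. \<exists>(p, q)\<in>S n.
        pm_dist x (u k) p < 1 / Suc i \<and> pm_dist z (v l) q < 1 / Suc i) \<or>
      (\<forall>\<^sub>F n in sequentially. \<not> (\<exists>(p, q)\<in>S n.
        pm_dist x (u k) p < 1 / Suc i \<and> pm_dist z (v l) q < 1 / Suc i))"
begin

sublocale MX: Metric_space "pm_points x" "pm_dist x" by simp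
sublocale MZ: Metric_space "pm_points z" "pm_dist z" by simp
sublocale PX: prob_space "pm_measure x" by (rule prob_space_pm_measure)
sublocale PZ: prob_space "pm_measure z" by (rule prob_space_pm_measure)

text \<open>The graph of the pointwise limit of the relations. Points near \<open>p\<close> are used
  because \<open>p\<close> itself need not be related to anything by \<open>S n\<close>.\<close>

definition limit_pair :: "'a \<Rightarrow> 'b \<Rightarrow> bool" where
  "limit_pair p q \<longleftrightarrow> q \<in> pm_points z \<and> (\<forall>\<epsilon>>0. \<forall>\<^sub>F n in sequentially.
     \<exists>(p', q')\<in>S n. pm_dist x p p' < \<epsilon> \<and> pm_dist z q q' < \<epsilon>)"

lemma error_eventually: "\<epsilon> > 0 \<Longrightarrow> \<forall>\<^sub>F n in sequentially. \<delta> n < \<epsilon>"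
  using order_tendstoD(2)[OF error_tendsto] by simp

lemma limit_pair_lipschitz:
  assumes p: "p \<in> pm_points x" "p' \<in> pm_points x" and "limit_pair p q" "limit_pair p' q'"
  shows "pm_dist z q q' \<le> pm_dist x p p'"
proof (rule field_le_epsilon)
  fix e :: real assume "e > 0"
  \<comment> \<open>Five errors occur: two distances in \<open>x\<close>, two in \<open>z\<close>,
    and \<open>\<delta> n\<close>.\<close>
  define \<epsilon> where "\<epsilon> = e / 5"
  have "\<epsilon> > 0" using \<open>e > 0\<close> by (simp add: \<epsilon>_def)
  have q: "q \<in> pm_points z" "q' \<in> pm_points z"
    using assms by (auto simp: limit_pair_def)
  have "\<forall>\<^sub>F n in sequentially. \<exists>(a, b)\<in>S n. pm_dist x p a < \<epsilon> \<and> pm_dist z q b < \<epsilon>"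
    "\<forall>\<^sub>F n in sequentially. \<exists>(a, b)\<in>S n. pm_dist x p' a < \<epsilon> \<and> pm_dist z q' b < \<epsilon>"
    using assms(3,4) \<open>\<epsilon> > 0\<close> by (simp_all add: limit_pair_def)
  with error_eventually[OF \<open>\<epsilon> > 0\<close>]
  have "\<forall>\<^sub>F n in sequentially. \<delta> n < \<epsilon> \<and>
    (\<exists>(a, b)\<in>S n. pm_dist x p a < \<epsilon> \<and> pm_dist z q b < \<epsilon>) \<and>
    (\<exists>(a, b)\<in>S n. pm_dist x p' a < \<epsilon> \<and> pm_dist z q' b < \<epsilon>)"
    by (intro eventually_conj)
  then obtain n where "\<delta> n < \<epsilon>" and
    "\<exists>(a, b)\<in>S n. pm_dist x p a < \<epsilon> \<and> pm_dist z q b < \<epsilon>"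
    "\<exists>(a, b)\<in>S n. pm_dist x p' a < \<epsilon> \<and> pm_dist z q' b < \<epsilon>"
    using eventually_happens'[OF sequentially_bot] by blast
  then obtain a b a' b' where n: "\<delta> n < \<epsilon>"
    and ab: "(a, b) \<in> S n" "pm_dist x p a < \<epsilon>" "pm_dist z q b < \<epsilon>"
    and ab': "(a', b') \<in> S n" "pm_dist x p' a' < \<epsilon>" "pm_dist z q' b' < \<epsilon>"
    by blast
  have pts: "a \<in> pm_points x" "b \<in> pm_points z" "a' \<in> pm_points x" "b' \<in> pm_points z"
    using in_points ab(1) ab'(1) by auto
  have "pm_dist z q q' \<le> pm_dist z q b + pm_dist z b b' + pm_dist z b' q'"
    using MZ.triangle[of q b q'] MZ.triangle[of b b' q'] q pts by simp
  moreover have "pm_dist z b b' \<le> pm_dist x a a' + \<delta> n"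
    by (rule lipschitz[OF ab(1) ab'(1)])
  moreover have "pm_dist x a a' \<le> pm_dist x a p + pm_dist x p p' + pm_dist x p' a'"
    using MX.triangle[of a p a'] MX.triangle[of p p' a'] p pts by simp
  ultimately show "pm_dist z q q' \<le> pm_dist x p p' + e"
    using ab ab' n MX.commute[of a p] MZ.commute[of b' q'] by (simp add: \<epsilon>_def)
qed

text \<open>One common index suffices for each radius: there the pair \<open>(p, c)\<close> can be
  compared with a pair near \<open>(p, q)\<close>, which puts \<open>c\<close> near
  \<open>q\<close>. Thus a frequent relation to \<open>C\<close> is enough, and this is what
  membership in a limsup of sets will supply.\<close>

lemma limit_pair_in_closed:
  assumes p: "p \<in> pm_points x" and q: "limit_pair p q"
    and C: "closedin MZ.mtopology C" and freq: "\<exists>\<^sub>F n in sequentially. \<exists>c\<in>C. (p, c) \<in> S n"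
  shows "q \<in> C"
proof -
  have qz: "q \<in> pm_points z"
    using q by (auto simp: limit_pair_def)
  have "\<exists>c\<in>C. c \<in> MZ.mball q r" if "r > 0" for r
  proof -
    define \<epsilon> where "\<epsilon> = r / 3"
    have "\<epsilon> > 0" using \<open>r > 0\<close> by (simp add: \<epsilon>_def)
    have "\<forall>\<^sub>F n in sequentially. \<exists>(a, b)\<in>S n. pm_dist x p a < \<epsilon> \<and> pm_dist z q b < \<epsilon>"
      using q \<open>\<epsilon> > 0\<close> by (simp add: limit_pair_def)
    with error_eventually[OF \<open>\<epsilon> > 0\<close>]
    have "\<forall>\<^sub>F n in sequentially. \<delta> n < \<epsilon> \<and>
      (\<exists>(a, b)\<in>S n. pm_dist x p a < \<epsilon> \<and> pm_dist z q b < \<epsilon>)"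
      by (rule eventually_conj)
    then obtain n where "\<delta> n < \<epsilon>" "\<exists>(a, b)\<in>S n. pm_dist x p a < \<epsilon> \<and> pm_dist z q b < \<epsilon>"
      "\<exists>c\<in>C. (p, c) \<in> S n"
      using frequently_eventually_conj[OF freq] frequently_ex by fast
    then obtain a b c where n: "\<delta> n < \<epsilon>" and ab: "(a, b) \<in> S n" "pm_dist x p a < \<epsilon>" "pm_dist z q b < \<epsilon>"
      and c: "c \<in> C" "(p, c) \<in> S n"
      by blast
    have pts: "a \<in> pm_points x" "b \<in> pm_points z" "c \<in> pm_points z"
      using in_points ab(1) c(2) by auto
    have "pm_dist z b c \<le> pm_dist x a p + \<delta> n"
      by (rule lipschitz[OF ab(1) c(2)])
    moreover have "pm_dist z q c \<le> pm_dist z q b + pm_dist z b c"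
      using MZ.triangle[of q b c] qz pts by simp
    ultimately have "pm_dist z q c < r"
      using n ab MX.commute[of a p] by (simp add: \<epsilon>_def)
    then show ?thesis
      using c(1) qz pts by auto
  qed
  then have "q \<in> MZ.mtopology closure_of C"
    unfolding MZ.metric_closure_of using qz by simp
  then show ?thesis
    using C by (simp add: closure_of_closedin)
qed

text \<open>
  Tightness: the ball \<open>B\<close> around \<open>p\<close> has positive measure, and finitely many small balls of \<open>z\<close>
  carry so much measure that the set of points related to them must meet \<open>B\<close>.
\<close>

lemma ex_near_pairs:
  assumes p: "p \<in> pm_points x" and "\<epsilon> > 0"
  shows "\<exists>w\<in>pm_points z. \<forall>\<^sub>F n in sequentially.
    \<exists>(p', q')\<in>S n. pm_dist x p p' < \<epsilon> \<and> pm_dist z w q' < \<epsilon>"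
proof -
  \<comment> \<open>\<open>decided\<close> covers only the points \<open>u k\<close>,
    \<open>v l\<close> and radii \<open>1 / Suc i\<close>, so \<open>p\<close> is replaced by a
    nearby \<open>u k\<close>; half of \<open>\<epsilon>\<close> is reserved for this shift.\<close>
  obtain i where i: "1 / Suc i < \<epsilon> / 2"
    using reals_Archimedean[of "\<epsilon> / 2"] \<open>\<epsilon> > 0\<close> by (auto simp: inverse_eq_divide)
  define \<rho> where "\<rho> = 1 / real (Suc i)"
  have \<rho>: "0 < \<rho>" "\<rho> < \<epsilon> / 2"
    using i by (simp_all add: \<rho>_def)
  obtain k where k: "pm_dist x p (u k) < \<rho>"
    using u_dense[OF p \<rho>(1)] ..
  define B where "B = MX.mball (u k) \<rho>"
  have Bo: "openin (mtopology_of (pm_metric x)) B"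
    by (simp add: B_def mtopology_of_def)
  have Bs: "B \<in> sets (pm_measure x)"
    by (rule openin_pm_measurable[OF Bo])
  have pB: "p \<in> B"
    using k p u_points by (simp add: B_def MX.commute)
  have "emeasure (pm_measure x) B > 0"
    using p full_support Bo pB unfolding pm_support_def by blast
  then have B0: "PX.prob B > 0"
    by (simp add: PX.emeasure_eq_measure)
  define V where "V N = (\<Union>l<N. MZ.mball (v l) \<rho>)" for N :: nat
  have Vs: "V N \<in> sets (pm_measure z)" for N
    unfolding V_def
    by (intro sets.finite_UN) (auto intro!: openin_pm_measurable simp: mtopology_of_def)
  have "(\<lambda>N. PZ.prob (V N)) \<longlonglongrightarrow> PZ.prob (\<Union>N. V N)"
  proof (rule PZ.finite_Lim_measure_incseq)
    show "incseq V"
      unfolding V_def by (intro monoI UN_mono) auto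
  qed (use Vs in blast)
  moreover have "(\<Union>N. V N) = space (pm_measure z)"
  proof
    show "(\<Union>N. V N) \<subseteq> space (pm_measure z)"
      by (auto simp: V_def space_pm_measure)
    show "space (pm_measure z) \<subseteq> (\<Union>N. V N)"
    proof
      fix q assume "q \<in> space (pm_measure z)"
      then have q: "q \<in> pm_points z" by (simp add: space_pm_measure)
      obtain l where "pm_dist z q (v l) < \<rho>"
        using v_dense[OF q \<rho>(1)] ..
      then have "q \<in> V (Suc l)"
        using q v_points by (auto simp: V_def MZ.commute intro!: bexI[of _ l])
      then show "q \<in> (\<Union>N. V N)" by blast
    qed
  qed
  ultimately have "(\<lambda>N. PZ.prob (V N)) \<longlonglongrightarrow> 1"
    by (simp add: PZ.prob_space)
  \<comment> \<open>Half of \<open>prob B\<close> may be lost here and less than the other half to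
    \<open>\<delta> n\<close>; the related set \<open>A\<close> then has mass above
    \<open>1 - prob B\<close> and cannot miss \<open>B\<close>.\<close>
  then have "\<forall>\<^sub>F N in sequentially. PZ.prob (V N) > 1 - PX.prob B / 2"
    by (rule order_tendstoD) (use B0 in simp)
  then obtain N where N: "PZ.prob (V N) > 1 - PX.prob B / 2"
    using eventually_happens'[OF sequentially_bot] by blast
  define P where "P l n \<longleftrightarrow> (\<exists>(p, q)\<in>S n. pm_dist x (u k) p < 1 / Suc i \<and> pm_dist z (v l) q < 1 / Suc i)"
    for l n
  have ex: "\<exists>l<N. P l n" if n: "\<delta> n < PX.prob B / 2" for n
  proof -
    obtain A where A: "A \<in> sets (pm_measure x)" "\<forall>p\<in>A. \<exists>q\<in>V N. (p, q) \<in> S n"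
      "PZ.prob (V N) \<le> PX.prob A + \<delta> n"
      using measure_le[OF Vs[of N], of n] by blast
    have "A \<inter> B \<noteq> {}"
    proof
      assume "A \<inter> B = {}"
      then have "PX.prob (A \<union> B) = PX.prob A + PX.prob B"
        using A(1) Bs by (simp add: PX.finite_measure_Union)
      then show False
        using PX.prob_le_1[of "A \<union> B"] N n A(3) by linarith
    qed
    then obtain a where a: "a \<in> A" "a \<in> B" by blast
    then obtain q where q: "q \<in> V N" "(a, q) \<in> S n"
      using A(2) by blast
    then obtain l where l: "l < N" "q \<in> MZ.mball (v l) \<rho>"
      unfolding V_def by blast
    have "pm_dist x (u k) a < 1 / Suc i \<and> pm_dist z (v l) q < 1 / Suc i"
      using a(2) l(2) unfolding B_def \<rho>_def by simp
    then have "P l n"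
      unfolding P_def using q(2) by blast
    then show ?thesis
      using l(1) by blast
  qed
  \<comment> \<open>The \<open>l\<close> found for each \<open>n\<close> may vary. If none of the
    finitely many worked eventually, \<open>decided\<close> would make all of them fail at the same
    late \<open>n\<close>.\<close>
  have "\<exists>l<N. \<forall>\<^sub>F n in sequentially. P l n"
  proof (rule ccontr)
    assume "\<not> ?thesis"
    then have "\<forall>l\<in>{..<N}. \<forall>\<^sub>F n in sequentially. \<not> P l n"
      using decided[of k i] unfolding P_def by blast
    then have "\<forall>\<^sub>F n in sequentially. \<forall>l\<in>{..<N}. \<not> P l n"
      by (rule eventually_ball_finite[rotated]) simp
    moreover have "\<forall>\<^sub>F n in sequentially. \<delta> n < PX.prob B / 2"
      using B0 by (intro error_eventually) simp
    ultimately have "\<forall>\<^sub>F n in sequentially. False"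
      by eventually_elim (use ex in blast)
    then show False by simp
  qed
  then obtain l where l: "\<forall>\<^sub>F n in sequentially. P l n"
    by blast
  have "\<forall>\<^sub>F n in sequentially. \<exists>(p', q')\<in>S n. pm_dist x p p' < \<epsilon> \<and> pm_dist z (v l) q' < \<epsilon>"
    using l
  proof eventually_elim
    case (elim n)
    then obtain a b where ab: "(a, b) \<in> S n" "pm_dist x (u k) a < \<rho>" "pm_dist z (v l) b < \<rho>"
      unfolding P_def \<rho>_def by blast
    then have "a \<in> pm_points x"
      using in_points by blast
    then have "pm_dist x p a < \<epsilon>"
      using MX.triangle[of p "u k" a] p u_points[of k] k ab(2) \<rho> by simp
    moreover have "pm_dist z (v l) b < \<epsilon>"
      using ab(3) \<rho> by simp
    ultimately show ?case
      using ab(1) by blast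
  qed
  then show ?thesis
    using v_points by blast
qed

text \<open>Near pairs at accuracy \<open>1 / Suc j\<close> give centres \<open>w j\<close>. Any two
  of them belong to pairs of the same relation over points near \<open>p\<close>, so the almost
  Lipschitz bound makes \<open>w\<close> a Cauchy sequence, and completeness of \<open>z\<close>
  provides \<open>q\<close>.\<close>

lemma ex_limit_pair:
  assumes p: "p \<in> pm_points x"
  shows "\<exists>q. limit_pair p q"
proof -
  have "\<exists>w. \<forall>j. w j \<in> pm_points z \<and> (\<forall>\<^sub>F n in sequentially.
    \<exists>(p', q')\<in>S n. pm_dist x p p' < 1 / Suc j \<and> pm_dist z (w j) q' < 1 / Suc j)"
    by (rule choice) (use ex_near_pairs[OF p] in \<open>simp add: Bex_def\<close>)
  then obtain w where w: "\<And>j. w j \<in> pm_points z" "\<And>j. \<forall>\<^sub>F n in sequentially.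
    \<exists>(p', q')\<in>S n. pm_dist x p p' < 1 / Suc j \<and> pm_dist z (w j) q' < 1 / Suc j"
    by blast
  \<comment> \<open>Each accuracy counts twice, once in \<open>x\<close> and once in
    \<open>z\<close>; \<open>e\<close> absorbs \<open>\<delta> n\<close>.\<close>
  have near: "pm_dist z (w j) (w k) \<le> 2 / Suc j + 2 / Suc k" for j k
  proof (rule field_le_epsilon)
    fix e :: real assume "e > 0"
    have "\<forall>\<^sub>F n in sequentially. \<delta> n < e \<and>
      (\<exists>(p', q')\<in>S n. pm_dist x p p' < 1 / Suc j \<and> pm_dist z (w j) q' < 1 / Suc j) \<and>
      (\<exists>(p', q')\<in>S n. pm_dist x p p' < 1 / Suc k \<and> pm_dist z (w k) q' < 1 / Suc k)"
      by (intro eventually_conj error_eventually w(2) \<open>e > 0\<close>)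
    then obtain n where "\<delta> n < e"
      "\<exists>(p', q')\<in>S n. pm_dist x p p' < 1 / Suc j \<and> pm_dist z (w j) q' < 1 / Suc j"
      "\<exists>(p', q')\<in>S n. pm_dist x p p' < 1 / Suc k \<and> pm_dist z (w k) q' < 1 / Suc k"
      using eventually_happens'[OF sequentially_bot] by blast
    then obtain a b a' b' where n: "\<delta> n < e"
      and ab: "(a, b) \<in> S n" "pm_dist x p a < 1 / Suc j" "pm_dist z (w j) b < 1 / Suc j"
      and ab': "(a', b') \<in> S n" "pm_dist x p a' < 1 / Suc k" "pm_dist z (w k) b' < 1 / Suc k"
      by blast
    have pts: "a \<in> pm_points x" "b \<in> pm_points z" "a' \<in> pm_points x" "b' \<in> pm_points z"
      using in_points ab(1) ab'(1) by auto
    have "pm_dist z b b' \<le> pm_dist x a a' + \<delta> n"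
      by (rule lipschitz[OF ab(1) ab'(1)])
    moreover have "pm_dist x a a' \<le> pm_dist x a p + pm_dist x p a'"
      using MX.triangle[of a p a'] p pts by simp
    moreover have "pm_dist z (w j) (w k) \<le> pm_dist z (w j) b + pm_dist z b b' + pm_dist z b' (w k)"
      using MZ.triangle[of "w j" b "w k"] MZ.triangle[of b b' "w k"] w(1) pts by simp
    ultimately have "pm_dist z (w j) (w k) \<le> (1 / Suc j + 1 / Suc j) + (1 / Suc k + 1 / Suc k) + e"
      using ab(2,3) ab'(2,3) n MX.commute[of a p] MZ.commute[of b' "w k"] by linarith
    then show "pm_dist z (w j) (w k) \<le> 2 / Suc j + 2 / Suc k + e"
      by simp
  qed
  have small: "\<exists>N. \<forall>j\<ge>N. 1 / real (Suc j) < e" if e: "e > 0" for e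
  proof -
    have "(\<lambda>j. 1 / real (Suc j)) \<longlonglongrightarrow> 0"
      using LIMSEQ_inverse_real_of_nat by (simp add: inverse_eq_divide)
    from order_tendstoD(2)[OF this e] show ?thesis
      by (simp add: eventually_sequentially)
  qed
  have "MZ.MCauchy w"
    unfolding MZ.MCauchy_def
  proof (intro conjI allI impI)
    show "range w \<subseteq> pm_points z" using w(1) by blast
    fix e :: real assume "e > 0"
    then obtain N where N: "\<And>j. j \<ge> N \<Longrightarrow> 1 / real (Suc j) < e / 4"
      using small[of "e / 4"] by auto
    have "pm_dist z (w j) (w k) < e" if "N \<le> j" "N \<le> k" for j k
      using near[of j k] N[OF that(1)] N[OF that(2)] by simp
    then show "\<exists>N. \<forall>n n'. N \<le> n \<longrightarrow> N \<le> n' \<longrightarrow> pm_dist z (w n) (w n') < e"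
      by blast
  qed
  moreover have "MZ.mcomplete"
    using is_pm_space[of z] by (simp add: is_pm_space_def mcomplete_of_def)
  ultimately obtain q where q: "limitin MZ.mtopology w q sequentially"
    unfolding MZ.mcomplete_def by blast
  then have qz: "q \<in> pm_points z"
    by (simp add: MZ.limit_metric_sequentially)
  have "\<forall>\<^sub>F n in sequentially. \<exists>(p', q')\<in>S n. pm_dist x p p' < \<epsilon> \<and> pm_dist z q q' < \<epsilon>"
    if \<epsilon>: "\<epsilon> > 0" for \<epsilon>
  proof -
    obtain N where N: "\<And>j. j \<ge> N \<Longrightarrow> 1 / real (Suc j) < \<epsilon> / 2"
      using small[of "\<epsilon> / 2"] \<epsilon> by auto
    have "\<exists>N. \<forall>n\<ge>N. w n \<in> pm_points z \<and> pm_dist z (w n) q < \<epsilon> / 2"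
      using q \<epsilon> half_gt_zero unfolding MZ.limit_metric_sequentially by blast
    then obtain N' where N': "\<And>j. j \<ge> N' \<Longrightarrow> pm_dist z (w j) q < \<epsilon> / 2"
      by blast
    define j where "j = max N N'"
    have j: "1 / real (Suc j) < \<epsilon> / 2" "pm_dist z (w j) q < \<epsilon> / 2"
      using N[of j] N'[of j] by (simp_all add: j_def)
    show ?thesis
      using w(2)[of j]
    proof eventually_elim
      case (elim n)
      then obtain a b where ab: "(a, b) \<in> S n" "pm_dist x p a < 1 / Suc j" "pm_dist z (w j) b < 1 / Suc j"
        by blast
      then have "b \<in> pm_points z"
        using in_points by blast
      then have "pm_dist z q b < \<epsilon>"
        using MZ.triangle[of q "w j" b] MZ.commute[of q "w j"] qz w(1)[of j] j ab(3) by simp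
      moreover have "pm_dist x p a < \<epsilon>"
        using ab(2) j(1) \<epsilon> by simp
      ultimately show ?case
        using ab(1) by blast
    qed
  qed
  then have "limit_pair p q"
    using qz by (simp add: limit_pair_def)
  then show ?thesis ..
qed

text \<open>\<open>limit_pair_lipschitz\<close> makes any choice of limits 1-Lipschitz, hence
  continuous and measurable. For closed \<open>C\<close>, the sets related to \<open>C\<close> have
  mass at least that of \<open>C\<close> up to \<open>\<delta> n\<close>, and their limsup lies in
  the preimage of \<open>C\<close>. This is the inequality on closed sets that
  \<open>pm_measure_eqI\<close> turns into equality of measures.\<close>

lemma pm_dominates: "pm_dominates x z"
proof -
  obtain f where f: "\<And>p. p \<in> pm_points x \<Longrightarrow> limit_pair p (f p)"
    using ex_limit_pair by metis
  have fz: "f p \<in> pm_points z" if "p \<in> pm_points x" for p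
    using f[OF that] by (simp add: limit_pair_def)
  have lip: "pm_dist z (f p) (f p') \<le> pm_dist x p p'" if "p \<in> pm_points x" "p' \<in> pm_points x" for p p'
    using that f by (intro limit_pair_lipschitz)
  have "Lipschitz_continuous_map (pm_metric x) (pm_metric z) f"
    unfolding Lipschitz_continuous_map_def using fz lip by (auto intro!: exI[of _ 1])
  then have cont: "continuous_map (mtopology_of (pm_metric x)) (mtopology_of (pm_metric z)) f"
    by (intro uniformly_continuous_imp_continuous_map Lipschitz_imp_uniformly_continuous_map)
  have preimage: "f -` C \<inter> pm_points x \<in> sets (pm_measure x)"
    if C: "closedin (mtopology_of (pm_metric z)) C" for C
  proof -
    have "{p \<in> pm_points x. f p \<in> C} \<in> sets (pm_measure x)"
      using closedin_continuous_map_preimage[OF cont C] closedin_pm_measurable by simp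
    moreover have "{p \<in> pm_points x. f p \<in> C} = f -` C \<inter> pm_points x" by blast
    ultimately show ?thesis by simp
  qed
  have meas: "f \<in> pm_measure x \<rightarrow>\<^sub>M pm_measure z"
    using fz preimage by (intro measurable_pm_measureI) (auto simp: space_pm_measure)
  have "PZ.prob C \<le> PX.prob (f -` C \<inter> pm_points x)"
    if C: "closedin (mtopology_of (pm_metric z)) C" for C
  proof -
    have "\<forall>n. \<exists>A\<in>sets (pm_measure x). (\<forall>p\<in>A. \<exists>q\<in>C. (p, q) \<in> S n) \<and>
        PZ.prob C \<le> PX.prob A + \<delta> n"
      by (intro allI measure_le closedin_pm_measurable C)
    then obtain A where A: "\<And>n. A n \<in> sets (pm_measure x)"
      "\<And>n p. p \<in> A n \<Longrightarrow> \<exists>q\<in>C. (p, q) \<in> S n" "\<And>n. PZ.prob C \<le> PX.prob (A n) + \<delta> n"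
      by metis
    \<comment> \<open>The intersection of the decreasing sets \<open>U m\<close> is the limsup of
      the \<open>A n\<close>, the points that lie in infinitely many of them.\<close>
    define U where "U m = (\<Union>n\<in>{m..}. A n)" for m
    have Us: "U m \<in> sets (pm_measure x)" for m
      unfolding U_def using A(1) by blast
    have lim: "(\<lambda>m. PX.prob (U m)) \<longlonglongrightarrow> PX.prob (\<Inter>m. U m)"
    proof (rule PX.finite_Lim_measure_decseq)
      show "decseq U"
        unfolding U_def by (intro antimonoI UN_mono) auto
    qed (use Us in blast)
    have "PZ.prob C \<le> PX.prob (U m)" for m
    proof -
      have "(\<lambda>n. PX.prob (U m) + \<delta> n) \<longlonglongrightarrow> PX.prob (U m) + 0"
        by (intro tendsto_add error_tendsto tendsto_const)
      moreover have "PZ.prob C \<le> PX.prob (U m) + \<delta> n" if "n \<ge> m" for n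
      proof -
        have "PX.prob (A n) \<le> PX.prob (U m)"
          using that Us by (intro PX.finite_measure_mono) (auto simp: U_def)
        then show ?thesis
          using A(3)[of n] by simp
      qed
      ultimately have "PZ.prob C \<le> PX.prob (U m) + 0"
        by (intro LIMSEQ_le_const) auto
      then show ?thesis by simp
    qed
    then have "PZ.prob C \<le> PX.prob (\<Inter>m. U m)"
      using LIMSEQ_le_const[OF lim] by blast
    also have "\<dots> \<le> PX.prob (f -` C \<inter> pm_points x)"
    proof (rule PX.finite_measure_mono[OF _ preimage[OF C]])
      show "(\<Inter>m. U m) \<subseteq> f -` C \<inter> pm_points x"
      proof
        fix p assume p: "p \<in> (\<Inter>m. U m)"
        have "p \<in> A n \<Longrightarrow> p \<in> pm_points x" for n
          using sets.sets_into_space[OF A(1)] by (auto simp: space_pm_measure)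
        then have px: "p \<in> pm_points x"
          using p by (auto simp: U_def)
        have "\<exists>\<^sub>F n in sequentially. \<exists>c\<in>C. (p, c) \<in> S n"
          unfolding frequently_sequentially
        proof
          fix m
          have "p \<in> U m" using p by blast
          then show "\<exists>n\<ge>m. \<exists>c\<in>C. (p, c) \<in> S n"
            unfolding U_def using A(2) by blast
        qed
        then have "f p \<in> C"
          using C by (intro limit_pair_in_closed[OF px f[OF px]]) (simp_all add: mtopology_of_def)
        then show "p \<in> f -` C \<inter> pm_points x"
          using px by simp
      qed
    qed
    finally show ?thesis .
  qed
  then have "distr (pm_measure x) (pm_measure z) f = pm_measure z"
    using meas
    by (intro pm_measure_eqI PX.prob_space_distr)
      (simp_all add: measure_distr closedin_pm_measurable space_pm_measure)
  then show ?thesis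
    unfolding pm_dominates_def using meas lip by blast
qed

end

text \<open>A point \<open>p\<close> is related to \<open>a s\<close> when \<open>b s\<close> is
  close to its image \<open>\<phi> p\<close>; closeness replaces equality since the parameter
  \<open>b\<close> need not be onto. In \<open>3 * \<epsilon>\<close>, one \<open>\<epsilon>\<close>
  comes from box-closeness and one from each of the two distances between \<open>b\<close> and
  \<open>\<phi>\<close>.\<close>

lemma ex_almost_lipschitz_relation:
  assumes "pm_dominates x y" "pm_box_close \<epsilon> z y" "\<epsilon> > 0"
  obtains R where "\<And>p q. (p, q) \<in> R \<Longrightarrow> p \<in> pm_points x \<and> q \<in> pm_points z"
    "\<And>p q p' q'. (p, q) \<in> R \<Longrightarrow> (p', q') \<in> R \<Longrightarrow>
      pm_dist z q q' \<le> pm_dist x p p' + 3 * \<epsilon>"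
    "\<And>C. C \<in> sets (pm_measure z) \<Longrightarrow>
      \<exists>A\<in>sets (pm_measure x). (\<forall>p\<in>A. \<exists>q\<in>C. (p, q) \<in> R) \<and>
        measure (pm_measure z) C \<le> measure (pm_measure x) A + 3 * \<epsilon>"
proof -
  interpret MX: Metric_space "pm_points x" "pm_dist x" by simp
  interpret MY: Metric_space "pm_points y" "pm_dist y" by simp
  interpret MZ: Metric_space "pm_points z" "pm_dist z" by simp
  obtain \<phi> where \<phi>: "\<phi> \<in> pm_measure x \<rightarrow>\<^sub>M pm_measure y"
    "\<And>s t. s \<in> pm_points x \<Longrightarrow> t \<in> pm_points x \<Longrightarrow> pm_dist y (\<phi> s) (\<phi> t) \<le> pm_dist x s t"
    "distr (pm_measure x) (pm_measure y) \<phi> = pm_measure y"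
    using assms(1) unfolding pm_dominates_def by blast
  obtain a b I where par: "pm_parameter z a" "pm_parameter y b"
    and I: "I \<in> sets borel" "I \<subseteq> {0..1}" "measure lborel I \<ge> 1 - \<epsilon>"
    and close: "\<And>s t. s \<in> I \<Longrightarrow> t \<in> I \<Longrightarrow> \<bar>pm_dist z (a s) (a t) - pm_dist y (b s) (b t)\<bar> \<le> \<epsilon>"
    using assms(2) unfolding pm_box_close_def by blast
  let ?L = "restrict_space lborel {0..1::real}"
  interpret L: prob_space ?L
    by (rule prob_spaceI) (simp add: space_restrict_space emeasure_restrict_space)
  have spL: "space ?L = {0..1}" by (simp add: space_restrict_space)
  have IL: "I \<in> sets ?L"
    using I by (simp add: sets_restrict_space_iff)
  have LI: "L.prob I \<ge> 1 - \<epsilon>"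
    using I by (simp add: measure_restrict_space)
  have a: "a \<in> ?L \<rightarrow>\<^sub>M pm_measure z" "distr ?L (pm_measure z) a = pm_measure z"
    and b: "b \<in> ?L \<rightarrow>\<^sub>M pm_measure y" "distr ?L (pm_measure y) b = pm_measure y"
    using par by (simp_all add: pm_parameter_def)
  have az: "a s \<in> pm_points z" and bY: "b s \<in> pm_points y" if "s \<in> I" for s
    using that I(2) par by (auto intro: pm_parameter_in_points)
  have \<phi>y: "\<phi> p \<in> pm_points y" if "p \<in> pm_points x" for p
    using measurable_space[OF \<phi>(1)] that by (simp add: space_pm_measure)
  define R where "R = {(p, a s) | p s. p \<in> pm_points x \<and> s \<in> I \<and> pm_dist y (b s) (\<phi> p) < \<epsilon>}"
  show ?thesis
  proof (rule that[of R])
    show "p \<in> pm_points x \<and> q \<in> pm_points z" if "(p, q) \<in> R" for p q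
      using that az by (auto simp: R_def)
    show "pm_dist z q q' \<le> pm_dist x p p' + 3 * \<epsilon>" if R: "(p, q) \<in> R" "(p', q') \<in> R" for p q p' q'
    proof -
      obtain s where s: "q = a s" "p \<in> pm_points x" "s \<in> I" "pm_dist y (b s) (\<phi> p) < \<epsilon>"
        using R(1) by (auto simp: R_def)
      obtain t where t: "q' = a t" "p' \<in> pm_points x" "t \<in> I" "pm_dist y (b t) (\<phi> p') < \<epsilon>"
        using R(2) by (auto simp: R_def)
      have "pm_dist z q q' \<le> pm_dist y (b s) (b t) + \<epsilon>"
        using close[OF s(3) t(3)] s(1) t(1) by simp
      moreover have "pm_dist y (b s) (b t) \<le> pm_dist y (b s) (\<phi> p) + pm_dist y (\<phi> p) (\<phi> p') + pm_dist y (b t) (\<phi> p')"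
        using MY.triangle[of "b s" "\<phi> p" "b t"] MY.triangle[of "\<phi> p" "\<phi> p'" "b t"]
          MY.commute[of "\<phi> p'" "b t"] bY[OF s(3)] bY[OF t(3)] \<phi>y[OF s(2)] \<phi>y[OF t(2)] by simp
      ultimately show ?thesis
        using \<phi>(2)[OF s(2) t(2)] s(4) t(4) by simp
    qed
    show "\<exists>A\<in>sets (pm_measure x). (\<forall>p\<in>A. \<exists>q\<in>C. (p, q) \<in> R) \<and>
        measure (pm_measure z) C \<le> measure (pm_measure x) A + 3 * \<epsilon>"
      if C: "C \<in> sets (pm_measure z)" for C
    proof -
      \<comment> \<open>The image under \<open>b\<close> of the parameters in \<open>I\<close> that
        \<open>a\<close> sends into \<open>C\<close> need not be measurable, but its neighbourhood
        \<open>W\<close> is open.\<close>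
      define W where "W = (\<Union>s\<in>{s\<in>I. a s \<in> C}. MY.mball (b s) \<epsilon>)"
      have "openin MY.mtopology W"
        unfolding W_def by (rule openin_Union) auto
      then have W: "W \<in> sets (pm_measure y)"
        by (simp add: openin_pm_measurable mtopology_of_def)
      define A where "A = \<phi> -` W \<inter> space (pm_measure x)"
      have "A \<in> sets (pm_measure x)"
        unfolding A_def using \<phi>(1) W by (rule measurable_sets)
      moreover have "\<exists>q\<in>C. (p, q) \<in> R" if "p \<in> A" for p
        using that by (auto simp: A_def W_def R_def space_pm_measure)
      moreover have "measure (pm_measure z) C \<le> measure (pm_measure x) A + 3 * \<epsilon>"
      proof -
        let ?aC = "a -` C \<inter> space ?L" and ?bW = "b -` W \<inter> space ?L"
        have sets: "?aC \<in> sets ?L" "?bW \<in> sets ?L"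
          using measurable_sets[OF a(1) C] measurable_sets[OF b(1) W] by simp_all
        have compl: "space ?L - I \<in> sets ?L"
          using IL by (rule sets.compl_sets)
        have "measure (pm_measure z) C = L.prob ?aC"
          using measure_distr[OF a(1) C] by (simp add: a(2))
        also have "\<dots> \<le> L.prob (?bW \<union> (space ?L - I))"
        proof (rule L.finite_measure_mono)
          show "?aC \<subseteq> ?bW \<union> (space ?L - I)"
            using bY \<open>\<epsilon> > 0\<close> by (auto simp: W_def)
        qed (intro sets.Un sets compl)
        also have "\<dots> \<le> L.prob ?bW + L.prob (space ?L - I)"
          using sets compl by (intro measure_subadditive) auto
        also have "L.prob (space ?L - I) \<le> \<epsilon>"
          using L.prob_compl[OF IL] LI by simp
        also have "L.prob ?bW = measure (pm_measure y) W"
          using measure_distr[OF b(1) W] by (simp add: b(2))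
        also have "\<dots> = measure (pm_measure x) A"
          using measure_distr[OF \<phi>(1) W] by (simp add: \<phi>(3) A_def)
        \<comment> \<open>Only the complement of \<open>I\<close> is lost, at cost
          \<open>\<epsilon>\<close>; the weaker \<open>3 * \<epsilon>\<close> lets both estimates
          share one error.\<close>
        finally show ?thesis using \<open>\<epsilon> > 0\<close> by simp
      qed
      ultimately show ?thesis by blast
    qed
  qed
qed

text \<open>Spaces dominated by \<open>X\<close> at distances below \<open>1 / Suc n\<close> from
  \<open>Z\<close> give the relations, and along a subsequence deciding countably many events they
  satisfy \<open>almost_lipschitz_relations\<close>.\<close>

lemma lip_le_of_box_limit:
  assumes "\<And>e. e > 0 \<Longrightarrow> \<exists>Y. box_dist Z Y < e \<and> Y \<preceq>\<^sub>L X"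
  shows "Z \<preceq>\<^sub>L X"
proof -
  obtain x z where x: "represents x X" and z: "represents z Z"
    using ex_represents by metis
  have "\<exists>\<epsilon> R. 0 < \<epsilon> \<and> \<epsilon> < 1 / Suc n \<and> (\<forall>p q. (p, q) \<in> R \<longrightarrow> p \<in> pm_points x \<and> q \<in> pm_points z) \<and>
    (\<forall>p q p' q'. (p, q) \<in> R \<longrightarrow> (p', q') \<in> R \<longrightarrow> pm_dist z q q' \<le> pm_dist x p p' + 3 * \<epsilon>) \<and>
    (\<forall>C\<in>sets (pm_measure z). \<exists>A\<in>sets (pm_measure x). (\<forall>p\<in>A. \<exists>q\<in>C. (p, q) \<in> R) \<and>
        measure (pm_measure z) C \<le> measure (pm_measure x) A + 3 * \<epsilon>)" for n
  proof -
    have "ennreal (1 / Suc n) > 0" by simp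
    then obtain Y where Y: "box_dist Z Y < ennreal (1 / Suc n)" "Y \<preceq>\<^sub>L X"
      using assms by blast
    obtain y where y: "represents y Y"
      using ex_represents ..
    obtain \<epsilon> where \<epsilon>: "\<epsilon> > 0" "ennreal \<epsilon> < ennreal (1 / Suc n)" "pm_box_close \<epsilon> z y"
      by (rule box_dist_lessD[OF Y(1) z y])
    have \<epsilon>n: "\<epsilon> < 1 / Suc n"
      using \<epsilon>(1,2) by (simp add: ennreal_less_iff)
    have "pm_dominates x y"
      using Y(2) lip_le_iff_dominates[OF x y] by simp
    then obtain R where R: "\<And>p q. (p, q) \<in> R \<Longrightarrow> p \<in> pm_points x \<and> q \<in> pm_points z"
      "\<And>p q p' q'. (p, q) \<in> R \<Longrightarrow> (p', q') \<in> R \<Longrightarrow> pm_dist z q q' \<le> pm_dist x p p' + 3 * \<epsilon>"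
      "\<And>C. C \<in> sets (pm_measure z) \<Longrightarrow>
        \<exists>A\<in>sets (pm_measure x). (\<forall>p\<in>A. \<exists>q\<in>C. (p, q) \<in> R) \<and>
          measure (pm_measure z) C \<le> measure (pm_measure x) A + 3 * \<epsilon>"
      by (rule ex_almost_lipschitz_relation[OF _ \<epsilon>(3,1)]) blast
    show ?thesis
      by (intro exI[of _ \<epsilon>] exI[of _ R] conjI allI impI ballI R \<epsilon>n \<epsilon>(1)) (use R(1) in auto)
  qed
  then obtain \<epsilon> R where \<epsilon>: "\<And>n. 0 < \<epsilon> n" "\<And>n. \<epsilon> n < 1 / Suc n"
    and R: "\<And>n p q. (p, q) \<in> R n \<Longrightarrow> p \<in> pm_points x \<and> q \<in> pm_points z"
      "\<And>n p q p' q'. (p, q) \<in> R n \<Longrightarrow> (p', q') \<in> R n \<Longrightarrow> pm_dist z q q' \<le> pm_dist x p p' + 3 * \<epsilon> n"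
      "\<And>n C. C \<in> sets (pm_measure z) \<Longrightarrow>
        \<exists>A\<in>sets (pm_measure x). (\<forall>p\<in>A. \<exists>q\<in>C. (p, q) \<in> R n) \<and>
          measure (pm_measure z) C \<le> measure (pm_measure x) A + 3 * \<epsilon> n"
    by metis
  obtain u :: "nat \<Rightarrow> real" where u: "\<And>k. u k \<in> pm_points x"
    "\<And>p e. p \<in> pm_points x \<Longrightarrow> e > 0 \<Longrightarrow> \<exists>k. pm_dist x p (u k) < e"
    by (rule pm_dense_sequence[of x]) blast
  obtain v :: "nat \<Rightarrow> real" where v: "\<And>k. v k \<in> pm_points z"
    "\<And>p e. p \<in> pm_points z \<Longrightarrow> e > 0 \<Longrightarrow> \<exists>k. pm_dist z p (v k) < e"
    by (rule pm_dense_sequence[of z]) blast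
  define P where "P k i l n \<longleftrightarrow> (\<exists>(p, q)\<in>R n.
    pm_dist x (u k) p < 1 / Suc i \<and> pm_dist z (v l) q < 1 / Suc i)" for k i l n
  \<comment> \<open>The triples \<open>(k, i, l)\<close> are packed into one natural number, as the
    diagonal argument handles a single index.\<close>
  define Q where "Q j = (case prod_decode j of (k, j') \<Rightarrow> case prod_decode j' of (i, l) \<Rightarrow> P k i l)" for j
  have Q: "Q (prod_encode (k, prod_encode (i, l))) = P k i l" for k i l
    by (simp add: Q_def)
  obtain r :: "nat \<Rightarrow> nat" where r: "strict_mono r"
    "\<And>j. (\<forall>\<^sub>F n in sequentially. Q j (r n)) \<or> (\<forall>\<^sub>F n in sequentially. \<not> Q j (r n))"
    by (rule ex_subseq_eventually_decided[of Q]) blast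
  have "\<epsilon> \<longlonglongrightarrow> 0"
  proof (rule tendsto_sandwich[of "\<lambda>_. 0"])
    show "(\<lambda>n. 1 / real (Suc n)) \<longlonglongrightarrow> 0"
      using LIMSEQ_inverse_real_of_nat by (simp add: inverse_eq_divide)
  qed (use \<epsilon> less_imp_le in \<open>auto intro!: always_eventually\<close>)
  then have "(\<lambda>n. 3 * (\<epsilon> \<circ> r) n) \<longlonglongrightarrow> 3 * 0"
    by (intro tendsto_mult tendsto_const LIMSEQ_subseq_LIMSEQ[OF _ r(1)])
  then have err: "(\<lambda>n. 3 * \<epsilon> (r n)) \<longlonglongrightarrow> 0"
    by simp
  interpret almost_lipschitz_relations x z "\<lambda>n. R (r n)" "\<lambda>n. 3 * \<epsilon> (r n)" u v
  proof
    show "pm_support x = pm_points x"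
      using x by (simp add: represents_def)
    show "(\<forall>\<^sub>F n in sequentially. \<exists>(p, q)\<in>R (r n).
        pm_dist x (u k) p < 1 / Suc i \<and> pm_dist z (v l) q < 1 / Suc i) \<or>
      (\<forall>\<^sub>F n in sequentially. \<not> (\<exists>(p, q)\<in>R (r n).
        pm_dist x (u k) p < 1 / Suc i \<and> pm_dist z (v l) q < 1 / Suc i))" for k i l
      using r(2)[of "prod_encode (k, prod_encode (i, l))"] unfolding Q P_def .
  qed (fact err R u v)+
  show ?thesis
    using pm_dominates lip_le_iff_dominates[OF x z] by simp
qed

lemma pyramid_of_in_pyramids: "pyramid_of X \<in> pyramids"
proof -
  have "openin box_topology (UNIV - pyramid_of X)"
    unfolding openin_box_topology
  proof
    fix Z assume "Z \<in> UNIV - pyramid_of X"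
    then have "\<not> Z \<preceq>\<^sub>L X"
      by (simp add: pyramid_of_def)
    then obtain e where "e > 0" "\<And>Y. box_dist Z Y < e \<Longrightarrow> \<not> Y \<preceq>\<^sub>L X"
      using lip_le_of_box_limit[of Z X] by blast
    then show "\<exists>\<epsilon>>0. \<forall>Y. box_dist Z Y < \<epsilon> \<longrightarrow> Y \<in> UNIV - pyramid_of X"
      by (intro exI[of _ e]) (auto simp: pyramid_of_def)
  qed
  then have "closedin box_topology (pyramid_of X)"
    by (simp add: closedin_def topspace_box_topology)
  moreover have "X \<in> pyramid_of X"
    by (simp add: pyramid_of_def lip_le_refl)
  moreover have "Z \<in> pyramid_of X" if "Y \<in> pyramid_of X" "Z \<preceq>\<^sub>L Y" for Y Z
    using that lip_le_trans[of Z Y X] by (simp add: pyramid_of_def)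
  \<comment> \<open>Directedness is witnessed by \<open>X\<close> itself, the largest
    element.\<close>
  moreover have "A \<preceq>\<^sub>L X" if "A \<in> pyramid_of X" for A
    using that by (simp add: pyramid_of_def)
  ultimately show ?thesis
    unfolding pyramids_def by blast
qed

section \<open>Existence of parameters\<close>

text \<open>
  A pm-space is a measurable retract of the real line: a point is encoded by the ternary expansion
  recording which balls of a countable base contain it, and is recovered as the limit of centres
  read off from the digits.
\<close>

definition cantor_code :: "(nat \<Rightarrow> bool) \<Rightarrow> real" where
  "cantor_code \<beta> = (\<Sum>k. (if \<beta> k then 2 else 0) * (1 / 3) ^ Suc k)"

text \<open>The shift that drops the leading ternary digit. Digits are 0 or 2, so codes avoid the
  gap between 1/3 and 2/3, and the threshold 1/2 inside it reads the digit. The formula makes sense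
  on all reals, as decoding must be Borel on the whole line.\<close>

primrec cantor_shift :: "nat \<Rightarrow> real \<Rightarrow> real" where
  "cantor_shift 0 y = y"
| "cantor_shift (Suc k) y = 3 * cantor_shift k y - (if cantor_shift k y \<ge> 1 / 2 then 2 else 0)"

lemma summable_cantor_code: "summable (\<lambda>k. (if \<beta> k then 2 else 0) * (1 / 3 :: real) ^ Suc k)"
proof (rule summable_comparison_test[of _ "\<lambda>k. 2 * (1 / 3 :: real) ^ Suc k"])
  show "summable (\<lambda>k. 2 * (1 / 3 :: real) ^ Suc k)"
    by (intro summable_mult summable_geometric summable_ignore_initial_segment[of _ 1, simplified]) simp
qed (auto intro!: exI[of _ 0])

lemma cantor_code_rec:
  "cantor_code \<beta> = ((if \<beta> 0 then 2 else 0) + cantor_code (\<lambda>k. \<beta> (Suc k))) / 3"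
proof -
  have "(\<Sum>k. (if \<beta> (Suc k) then 2 else 0) * (1 / 3 :: real) ^ Suc (Suc k)) =
      (\<Sum>k. (if \<beta> (Suc k) then 2 else 0) * (1 / 3) ^ Suc k * (1 / 3))"
    by (simp add: mult_ac)
  also have "\<dots> = cantor_code (\<lambda>k. \<beta> (Suc k)) * (1 / 3)"
    unfolding cantor_code_def by (rule suminf_mult2[OF summable_cantor_code, symmetric])
  finally show ?thesis
    using suminf_split_head[OF summable_cantor_code[of \<beta>]] unfolding cantor_code_def by simp
qed

lemma cantor_code_bounds: "0 \<le> cantor_code \<beta>" "cantor_code \<beta> \<le> 1"
proof -
  show "0 \<le> cantor_code \<beta>"
    unfolding cantor_code_def by (intro suminf_nonneg summable_cantor_code) auto
  have "(\<lambda>k. (1 / 3 :: real) ^ k) sums (1 / (1 - 1 / 3))"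
    by (rule geometric_sums) simp
  then have "(\<lambda>k. 2 / 3 * (1 / 3 :: real) ^ k) sums (2 / 3 * (1 / (1 - 1 / 3)))"
    by (rule sums_mult)
  then have s: "(\<lambda>k. 2 * (1 / 3 :: real) ^ Suc k) sums 1"
    by simp
  have "cantor_code \<beta> \<le> (\<Sum>k. 2 * (1 / 3 :: real) ^ Suc k)"
    unfolding cantor_code_def using s by (intro suminf_le summable_cantor_code) (auto simp: sums_iff)
  then show "cantor_code \<beta> \<le> 1"
    using s by (simp add: sums_iff)
qed

lemma cantor_code_ge_half_iff: "cantor_code \<beta> \<ge> 1 / 2 \<longleftrightarrow> \<beta> 0"
  using cantor_code_rec[of \<beta>] cantor_code_bounds[of "\<lambda>k. \<beta> (Suc k)"] by (cases "\<beta> 0") auto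

lemma cantor_shift_code: "cantor_shift k (cantor_code \<beta>) = cantor_code (\<lambda>j. \<beta> (k + j))"
proof (induction k)
  case (Suc k)
  have "cantor_shift (Suc k) (cantor_code \<beta>) = cantor_code (\<lambda>j. \<beta> (k + Suc j))"
    using cantor_code_rec[of "\<lambda>j. \<beta> (k + j)"] cantor_code_ge_half_iff[of "\<lambda>j. \<beta> (k + j)"]
    by (simp add: Suc)
  then show ?case by simp
qed simp

lemma cantor_digit: "cantor_shift k (cantor_code \<beta>) \<ge> 1 / 2 \<longleftrightarrow> \<beta> k"
  unfolding cantor_shift_code cantor_code_ge_half_iff by simp

lemma measurable_cantor_shift [measurable]: "cantor_shift k \<in> borel_measurable borel"
proof (induction k)
  case 0
  have "cantor_shift 0 = (\<lambda>y. y)" by auto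
  then show ?case by simp
next
  case (Suc k)
  note [measurable] = Suc
  have "cantor_shift (Suc k) = (\<lambda>y. 3 * cantor_shift k y - (if cantor_shift k y \<ge> 1 / 2 then 2 else 0))"
    by auto
  then show ?case by simp
qed

text \<open>The explicit rate is the point: it lets the limit be located relative to a closed set by
  testing each \<open>s n\<close> separately. The constant 4 is the sum of the remaining steps
  \<open>2 * (1 / 2) ^ j\<close> over \<open>j \<ge> n\<close>, divided by
  \<open>(1 / 2) ^ n\<close>.\<close>

lemma (in Metric_space) dyadic_Cauchy_limit:
  assumes "mcomplete" and s: "\<And>n. s n \<in> M" and step: "\<And>n. d (s n) (s (Suc n)) < 2 * (1 / 2) ^ n"
  shows "\<exists>q\<in>M. \<forall>n. d (s n) q \<le> 4 * (1 / 2) ^ n"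
proof -
  \<comment> \<open>The exact geometric partial sum is kept so that the induction closes.\<close>
  have tail: "d (s n) (s (n + k)) \<le> 4 * (1 / 2) ^ n * (1 - (1 / 2) ^ k)" for n k
  proof (induction k)
    case (Suc k)
    have "d (s n) (s (n + Suc k)) \<le> d (s n) (s (n + k)) + d (s (n + k)) (s (Suc (n + k)))"
      using triangle[OF s s s] by simp
    also have "\<dots> \<le> 4 * (1 / 2) ^ n * (1 - (1 / 2) ^ k) + 2 * (1 / 2) ^ (n + k)"
      using Suc step[of "n + k"] by simp
    also have "\<dots> = 4 * (1 / 2) ^ n * (1 - (1 / 2) ^ Suc k)"
      by (simp add: power_add algebra_simps)
    finally show ?case .
  qed (simp add: s)
  have tail': "d (s n) (s m) \<le> 4 * (1 / 2) ^ n" if "n \<le> m" for n m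
  proof -
    have "d (s n) (s m) \<le> 4 * (1 / 2) ^ n * (1 - (1 / 2) ^ (m - n))"
      using tail[of n "m - n"] that by simp
    also have "\<dots> \<le> 4 * (1 / 2) ^ n * 1"
      by (intro mult_left_mono) auto
    finally show ?thesis by simp
  qed
  have zero: "(\<lambda>n. 4 * (1 / 2 :: real) ^ n) \<longlonglongrightarrow> 0"
    using tendsto_mult[OF tendsto_const LIMSEQ_power_zero[of "1 / 2 :: real"], of 4] by simp
  have "MCauchy s"
    unfolding MCauchy_def
  proof (intro conjI allI impI)
    show "range s \<subseteq> M" using s by blast
    fix e :: real assume "e > 0"
    then obtain N where N: "\<And>n. n \<ge> N \<Longrightarrow> 4 * (1 / 2 :: real) ^ n < e"
      using order_tendstoD(2)[OF zero, of e] by (auto simp: eventually_sequentially)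
    have "d (s n) (s n') < e" if "N \<le> n" "N \<le> n'" for n n'
    proof (cases "n \<le> n'")
      case True
      then show ?thesis using tail'[of n n'] N[of n] that by simp
    next
      case False
      then show ?thesis using tail'[of n' n] N[of n'] that commute[of "s n" "s n'"] by simp
    qed
    then show "\<exists>N. \<forall>n n'. N \<le> n \<longrightarrow> N \<le> n' \<longrightarrow> d (s n) (s n') < e" by blast
  qed
  then obtain q where q: "limitin mtopology s q sequentially"
    using \<open>mcomplete\<close> unfolding mcomplete_def by blast
  then have qM: "q \<in> M" by (simp add: limit_metric_sequentially)
  have "d (s n) q \<le> 4 * (1 / 2) ^ n" for n
  proof (rule field_le_epsilon)
    fix e :: real assume "e > 0"
    then obtain N where N: "\<And>m. m \<ge> N \<Longrightarrow> d (s m) q < e"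
      using q unfolding limit_metric_sequentially by blast
    have "d (s n) q \<le> d (s n) (s (max n N)) + d (s (max n N)) q"
      by (rule triangle[OF s s qM])
    then show "d (s n) q \<le> 4 * (1 / 2) ^ n + e"
      using tail'[of n "max n N"] N[of "max n N"] by simp
  qed
  then show ?thesis using qM by blast
qed

lemma pm_space_borel_retract:
  fixes x :: "'a pm_space"
  obtains h :: "'a \<Rightarrow> real" and g :: "real \<Rightarrow> 'a" where "h \<in> borel_measurable (pm_measure x)"
    "g \<in> borel \<rightarrow>\<^sub>M pm_measure x" "\<And>p. p \<in> pm_points x \<Longrightarrow> g (h p) = p"
proof -
  interpret MX: Metric_space "pm_points x" "pm_dist x" by simp
  have complete: "MX.mcomplete"
    using is_pm_space[of x] by (simp add: is_pm_space_def mcomplete_of_def)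
  obtain v :: "nat \<Rightarrow> 'a" where v: "\<And>l. v l \<in> pm_points x"
    "\<And>p e. p \<in> pm_points x \<Longrightarrow> e > 0 \<Longrightarrow> \<exists>l. pm_dist x p (v l) < e"
    by (rule pm_dense_sequence[of x]) blast
  define E where "E k = (case prod_decode k of (n, l) \<Rightarrow> MX.mball (v l) ((1 / 2) ^ n))" for k
  have E[measurable]: "E k \<in> sets (pm_measure x)" for k
    unfolding E_def by (auto simp: mtopology_of_def split: prod.split intro!: openin_pm_measurable)
  define h where "h p = cantor_code (\<lambda>k. p \<in> E k)" for p
  have h: "h \<in> borel_measurable (pm_measure x)"
    unfolding h_def cantor_code_def by measurable
  \<comment> \<open>On the code of \<open>p\<close> this is the first dense point whose ball of
    radius \<open>(1 / 2) ^ n\<close> contains \<open>p\<close>; where no digit is set,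
    \<open>LEAST\<close> is some fixed number.\<close>
  define idx where "idx n y = (LEAST l. cantor_shift (prod_encode (n, l)) y \<ge> 1 / 2)" for n y
  have idx[measurable]: "idx n \<in> borel \<rightarrow>\<^sub>M count_space UNIV" for n
    unfolding idx_def by measurable
  define s where "s y n = v (idx n y)" for y n
  have s: "s y n \<in> pm_points x" for y n
    by (simp add: s_def v)
  have sh: "pm_dist x (s (h p) n) p < (1 / 2) ^ n" if p: "p \<in> pm_points x" for p n
  proof -
    have dig: "cantor_shift (prod_encode (n, l)) (h p) \<ge> 1 / 2 \<longleftrightarrow> p \<in> MX.mball (v l) ((1 / 2) ^ n)" for l
      unfolding h_def cantor_digit by (simp add: E_def)
    obtain l where "pm_dist x p (v l) < (1 / 2) ^ n"
      using v(2)[OF p, of "(1 / 2) ^ n"] by auto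
    then have "p \<in> MX.mball (v l) ((1 / 2) ^ n)"
      using p v by (simp add: MX.commute)
    then have "cantor_shift (prod_encode (n, idx n (h p))) (h p) \<ge> 1 / 2"
      unfolding idx_def dig[symmetric] by (rule LeastI)
    then show ?thesis
      unfolding dig by (simp add: s_def)
  qed
  \<comment> \<open>Every code lies in this Borel set, because
    \<open>(1 / 2) ^ n + (1 / 2) ^ Suc n\<close> is less than \<open>2 * (1 / 2) ^ n\<close>.
    Outside it the decoder takes the constant value \<open>v 0\<close>.\<close>
  define G where "G = {y. \<forall>n. pm_dist x (s y n) (s y (Suc n)) < 2 * (1 / 2) ^ n}"
  have "(\<lambda>y. pm_dist x (v (idx n y)) (v (idx (Suc n) y))) \<in> borel_measurable borel" for n
    by (rule measurable_compose_countable[OF _ idx[of n]],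
        rule measurable_compose_countable[OF _ idx[of "Suc n"]]) simp
  then have [measurable]: "(\<lambda>y. pm_dist x (s y n) (s y (Suc n))) \<in> borel_measurable borel" for n
    by (simp add: s_def)
  have G[measurable]: "G \<in> sets borel"
    unfolding G_def by measurable
  have lim: "\<exists>q\<in>pm_points x. \<forall>n. pm_dist x (s y n) q \<le> 4 * (1 / 2) ^ n" if "y \<in> G" for y
    using that s by (intro MX.dyadic_Cauchy_limit[OF complete]) (auto simp: G_def)
  define g where "g y = (if y \<in> G then SOME q. q \<in> pm_points x \<and> (\<forall>n. pm_dist x (s y n) q \<le> 4 * (1 / 2) ^ n)
    else v 0)" for y
  have gG: "g y \<in> pm_points x \<and> (\<forall>n. pm_dist x (s y n) (g y) \<le> 4 * (1 / 2) ^ n)" if "y \<in> G" for y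
    using lim[OF that] that someI_ex[of "\<lambda>q. q \<in> pm_points x \<and> (\<forall>n. pm_dist x (s y n) q \<le> 4 * (1 / 2) ^ n)"]
    unfolding g_def by auto
  have gx: "g y \<in> pm_points x" for y
    using gG[of y] v by (cases "y \<in> G") (auto simp: g_def)
  have small: "\<exists>n. c * (1 / 2 :: real) ^ n < e" if "e > 0" for c e :: real
  proof -
    have "(\<lambda>n. c * (1 / 2 :: real) ^ n) \<longlonglongrightarrow> 0"
      using tendsto_mult[OF tendsto_const LIMSEQ_power_zero[of "1 / 2 :: real"], of c] by simp
    from order_tendstoD(2)[OF this that] show ?thesis
      using eventually_happens'[OF sequentially_bot] by blast
  qed
  show ?thesis
  proof (rule that[OF h])
    show "g \<in> borel \<rightarrow>\<^sub>M pm_measure x"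
    proof (rule measurable_pm_measureI)
      show "g \<in> space borel \<rightarrow> pm_points x" using gx by blast
      fix C assume C: "closedin (mtopology_of (pm_metric x)) C"
      \<comment> \<open>The condition constrains only the natural number \<open>idx n y\<close>,
        hence is measurable in \<open>y\<close>. The 8 leaves strict room above the error 4 of
        \<open>s y n\<close>; conversely, 8 and 4 add up to the 12 below, and closedness of
        \<open>C\<close> finishes.\<close>
      define K where "K n = {l. \<exists>c\<in>C. pm_dist x (v l) c < 8 * (1 / 2) ^ n}" for n :: nat
      have inC: "g y \<in> C \<longleftrightarrow> (\<forall>n. idx n y \<in> K n)" if y: "y \<in> G" for y
      proof
        assume "g y \<in> C"
        moreover have "pm_dist x (v (idx n y)) (g y) < 8 * (1 / 2) ^ n" for n
        proof -
          have "(0::real) < (1 / 2) ^ n" by simp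
          then show ?thesis using gG[OF y] unfolding s_def by (smt (verit))
        qed
        ultimately show "\<forall>n. idx n y \<in> K n"
          unfolding K_def by blast
      next
        assume K: "\<forall>n. idx n y \<in> K n"
        have "\<exists>c\<in>C. c \<in> MX.mball (g y) r" if "r > 0" for r
        proof -
          obtain n where n: "12 * (1 / 2 :: real) ^ n < r"
            using small[OF \<open>r > 0\<close>] by blast
          obtain c where c: "c \<in> C" "pm_dist x (s y n) c < 8 * (1 / 2) ^ n"
            using K unfolding K_def s_def by blast
          have cx: "c \<in> pm_points x"
            using c(1) closedin_subset[OF C] by auto
          have "pm_dist x (g y) c \<le> pm_dist x (s y n) (g y) + pm_dist x (s y n) c"
            using MX.triangle[OF gx s cx] MX.commute[of "g y" "s y n"] by metis
          moreover have "pm_dist x (s y n) (g y) \<le> 4 * (1 / 2) ^ n"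
            using gG[OF y] by blast
          ultimately have "pm_dist x (g y) c < r"
            using n c(2) by linarith
          then show ?thesis using c(1) cx gx by auto
        qed
        then have "g y \<in> MX.mtopology closure_of C"
          unfolding MX.metric_closure_of using gx by simp
        then show "g y \<in> C"
          using C by (simp add: closure_of_closedin mtopology_of_def)
      qed
      have "g -` C \<inter> space borel = (G \<inter> {y. \<forall>n. idx n y \<in> K n}) \<union> (if v 0 \<in> C then - G else {})"
      proof -
        have gv: "g y = v 0" if "y \<notin> G" for y using that by (simp add: g_def)
        have "g y \<in> C \<longleftrightarrow> y \<in> G \<and> (\<forall>n. idx n y \<in> K n) \<or> y \<notin> G \<and> v 0 \<in> C" for y
          using inC[of y] gv[of y] by (cases "y \<in> G") simp_all
        then show ?thesis by auto
      qed
      also have "\<dots> \<in> sets borel"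
      proof (rule sets.Un)
        show "G \<inter> {y. \<forall>n. idx n y \<in> K n} \<in> sets borel"
          by measurable
        show "(if v 0 \<in> C then - G else {}) \<in> sets borel"
          by (simp add: borel_comp G)
      qed
      finally show "g -` C \<inter> space borel \<in> sets borel" .
    qed
    show "g (h p) = p" if p: "p \<in> pm_points x" for p
    proof -
      have "pm_dist x (s (h p) n) (s (h p) (Suc n)) < 2 * (1 / 2) ^ n" for n
      proof -
        have "pm_dist x (s (h p) n) (s (h p) (Suc n)) \<le> pm_dist x (s (h p) n) p + pm_dist x (s (h p) (Suc n)) p"
          using MX.triangle[OF s p s] MX.commute[of p "s (h p) (Suc n)"] by metis
        also have "\<dots> < (1 / 2) ^ n + (1 / 2) ^ Suc n"
          using sh[OF p, of n] sh[OF p, of "Suc n"] by linarith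
        also have "\<dots> \<le> 2 * (1 / 2) ^ n" by simp
        finally show ?thesis .
      qed
      then have "h p \<in> G" by (simp add: G_def)
      then have near: "pm_dist x (s (h p) n) (g (h p)) \<le> 4 * (1 / 2) ^ n" for n
        using gG by blast
      have "pm_dist x (g (h p)) p \<le> 0"
      proof (rule field_le_epsilon)
        fix e :: real assume "e > 0"
        then obtain n where n: "5 * (1 / 2 :: real) ^ n < e"
          using small by blast
        have "pm_dist x (g (h p)) p \<le> pm_dist x (s (h p) n) (g (h p)) + pm_dist x (s (h p) n) p"
          using MX.triangle[OF gx s p] MX.commute[of "g (h p)" "s (h p) n"] by metis
        then show "pm_dist x (g (h p)) p \<le> 0 + e"
          using near[of n] sh[OF p, of n] n by linarith
      qed
      then show ?thesis
        using MX.nonneg[of "g (h p)" p] MX.zero[OF gx p] by simp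
    qed
  qed
qed

text \<open>The measure is moved to the line by \<open>h\<close>, where the quantile function
  \<open>\<mu>.I\<close> realises its image as a law of a uniform variable; \<open>g\<close> moves
  it back, since \<open>g \<circ> h\<close> is the identity on points.\<close>

lemma ex_pm_parameter:
  fixes x :: "'a pm_space"
  shows "\<exists>a. pm_parameter x a"
proof -
  interpret PX: prob_space "pm_measure x" by (rule prob_space_pm_measure)
  obtain h :: "'a \<Rightarrow> real" and g where h: "h \<in> borel_measurable (pm_measure x)" and g: "g \<in> borel \<rightarrow>\<^sub>M pm_measure x"
    and gh: "\<And>p. p \<in> pm_points x \<Longrightarrow> g (h p) = p"
    by (rule pm_space_borel_retract[of x]) blast
  define \<mu> where "\<mu> = distr (pm_measure x) borel h"
  interpret \<mu>: cdf_distribution \<mu>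
    unfolding cdf_distribution_def \<mu>_def real_distribution_def real_distribution_axioms_def
    using PX.prob_space_distr[OF h] by simp
  let ?L = "restrict_space lborel {0..1::real}"
  \<comment> \<open>The quantile function is used on the open interval only. The two endpoints form
    a null set and get the value 0, which accounts for the set \<open>N\<close> below.\<close>
  define c where "c t = (if t \<in> {0<..<1} then \<mu>.I t else 0)" for t :: real
  have pre: "c -` A \<inter> {0..1} \<in> sets borel \<and>
      emeasure lborel (c -` A \<inter> {0..1}) = emeasure \<mu> A" if A: "A \<in> sets borel" for A
  proof -
    have "sets (restrict_space lborel {0<..<1::real}) = sets (restrict_space borel {0<..<1})"
      by (simp add: sets_restrict_space)
    then have I: "\<mu>.I \<in> restrict_space lborel {0<..<1} \<rightarrow>\<^sub>M borel"
      using \<mu>.measurable_CI measurable_cong_sets by blast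
    define B where "B = \<mu>.I -` A \<inter> {0<..<1}"
    have B: "B \<in> sets borel"
      using measurable_sets[OF I A] by (simp add: B_def space_restrict_space sets_restrict_space_iff)
    define N where "N = {t \<in> {0, 1::real}. 0 \<in> A}"
    have N: "N \<in> null_sets lborel"
      unfolding N_def by (rule finite_imp_null_set_lborel) simp
    have eq: "c -` A \<inter> {0..1} = B \<union> N"
      by (auto simp: B_def N_def c_def split: if_splits)
    have "emeasure \<mu> A = emeasure (distr (restrict_space lborel {0<..<1}) borel \<mu>.I) A"
      by (simp add: \<mu>.distr_I_eq_M)
    also have "\<dots> = emeasure lborel B"
      using A by (simp add: emeasure_distr[OF I] space_restrict_space emeasure_restrict_space B_def)
    also have "\<dots> = emeasure lborel (B \<union> N)"
      using B N by (simp add: emeasure_Un_null_set)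
    finally show ?thesis
      using eq B N by auto
  qed
  have c: "c \<in> ?L \<rightarrow>\<^sub>M borel"
    by (rule measurableI) (use pre in \<open>simp_all add: space_restrict_space sets_restrict_space_iff\<close>)
  have "distr ?L borel c = \<mu>"
  proof (rule measure_eqI)
    fix A assume "A \<in> sets (distr ?L borel c)"
    then show "emeasure (distr ?L borel c) A = emeasure \<mu> A"
      using pre[of A] by (simp add: emeasure_distr[OF c] space_restrict_space emeasure_restrict_space)
  qed (simp add: \<mu>_def)
  then have "distr ?L (pm_measure x) (g \<circ> c) = distr \<mu> (pm_measure x) g"
    using distr_distr[OF g c] by simp
  also have "\<dots> = distr (pm_measure x) (pm_measure x) (g \<circ> h)"
    unfolding \<mu>_def by (rule distr_distr[OF g h])
  also have "\<dots> = distr (pm_measure x) (pm_measure x) (\<lambda>p. p)"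
    by (rule distr_cong) (simp_all add: gh space_pm_measure)
  also have "\<dots> = pm_measure x"
    by (rule distr_id2) simp
  finally have "pm_parameter x (g \<circ> c)"
    unfolding pm_parameter_def using measurable_comp[OF c g] by simp
  then show ?thesis
    by blast
qed

section \<open>Separability of the box topology and exhaustion of pyramids\<close>

text \<open>Finite unions of members of a countable base suffice: between a compact inner and an
  open outer approximation of \<open>A\<close>, a finite subcover gives a \<open>J\<close>, and its
  symmetric difference with \<open>A\<close> lies in the two approximation errors.\<close>

lemma countable_approximating_borel_sets:
  obtains \<J> :: "real set set" where "countable \<J>" "\<J> \<subseteq> sets borel"
    "\<And>A e. A \<in> sets borel \<Longrightarrow> A \<subseteq> {0..1} \<Longrightarrow> e > 0 \<Longrightarrow>
      \<exists>J\<in>\<J>. emeasure lborel ((A - J) \<union> (J - A)) \<le> ennreal e"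
proof -
  obtain B :: "real set set" where B: "countable B" "topological_basis B"
    using ex_countable_basis by blast
  define \<J> where "\<J> = Union ` {F. finite F \<and> F \<subseteq> B}"
  show ?thesis
  proof (rule that[of \<J>])
    show "countable \<J>"
      unfolding \<J>_def using countable_Collect_finite_subset[OF B(1)] by (rule countable_image)
    have openJ: "open J" if "J \<in> \<J>" for J
      using that topological_basis_open[OF B(2)] by (auto simp: \<J>_def intro!: open_Union)
    then show "\<J> \<subseteq> sets borel" by auto
    fix A :: "real set" and e :: real
    assume A: "A \<in> sets borel" "A \<subseteq> {0..1}" and "e > 0"
    then have "A \<in> sets lebesgue" "e / 2 > 0" by auto
    obtain T where T: "open T" "A \<subseteq> T" "emeasure lebesgue (T - A) < ennreal (e / 2)"
      by (rule sets_lebesgue_outer_open[OF \<open>A \<in> sets lebesgue\<close> \<open>e / 2 > 0\<close>])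
    obtain K where K: "closed K" "K \<subseteq> A" "emeasure lebesgue (A - K) < ennreal (e / 2)"
      by (rule sets_lebesgue_inner_closed[OF \<open>A \<in> sets lebesgue\<close> \<open>e / 2 > 0\<close>])
    have "compact K"
      using K A(2) by (meson bounded_closed_interval bounded_subset compact_eq_bounded_closed)
    obtain B' where B': "B' \<subseteq> B" "\<Union>B' = T"
      using B(2) T(1) unfolding topological_basis_def by blast
    have "K \<subseteq> \<Union>B'"
      using B' K(2) T(2) by blast
    then obtain F where F: "F \<subseteq> B'" "finite F" "K \<subseteq> \<Union>F"
      using compactE[OF \<open>compact K\<close>, of B'] B' topological_basis_open[OF B(2)] by blast
    define J where "J = \<Union>F"
    have J: "J \<in> \<J>" "K \<subseteq> J" "J \<subseteq> T"
      unfolding J_def \<J>_def using F B' by blast+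
    have "emeasure lborel ((A - J) \<union> (J - A)) \<le> emeasure lborel ((A - K) \<union> (T - A))"
      using J K T A by (intro emeasure_mono) auto
    also have "\<dots> \<le> emeasure lborel (A - K) + emeasure lborel (T - A)"
      using K T A by (intro emeasure_subadditive) auto
    also have "\<dots> \<le> ennreal (e / 2) + ennreal (e / 2)"
      using T(3) K(3) K(1) T(1) A(1)
      by (intro add_mono) (simp_all add: emeasure_completion less_imp_le)
    also have "\<dots> = ennreal e"
      using \<open>e > 0\<close> by (simp flip: ennreal_plus)
    finally show "\<exists>J\<in>\<J>. emeasure lborel ((A - J) \<union> (J - A)) \<le> ennreal e"
      using J(1) by blast
  qed
qed

text \<open>
  A pattern ranges over a countable set once the sets in \<open>Js\<close> do, and two spaces with a common
  pattern are box-close.  This gives countable dense subsets of arbitrary sets of classes without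
  the triangle inequality for the box distance.
\<close>

definition distance_pattern ::
    "real \<Rightarrow> 'a pm_space \<Rightarrow> real set list \<Rightarrow> int list list \<Rightarrow> bool" where
  "distance_pattern \<epsilon> x Js D \<longleftrightarrow> (\<exists>a I. pm_parameter x a \<and> I \<in> sets borel \<and> I \<subseteq> {0..1} \<and>
     measure lborel I \<ge> 1 - \<epsilon> \<and> I \<subseteq> \<Union>(set Js) \<and>
     (\<forall>i<length Js. \<forall>j<length Js. \<forall>s\<in>I \<inter> Js ! i. \<forall>t\<in>I \<inter> Js ! j.
        \<bar>pm_dist x (a s) (a t) - \<epsilon> * D ! i ! j\<bar> \<le> 3 * \<epsilon>))"

text \<open>On \<open>I \<inter> I'\<close> both distances are within \<open>3 * \<epsilon>\<close>
  of the same matrix entry, so they differ by at most \<open>6 * \<epsilon>\<close>; the lost mass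
  is at most \<open>2 * \<epsilon>\<close>.\<close>

lemma distance_pattern_imp_box_close:
  assumes "distance_pattern \<epsilon> x Js D" "distance_pattern \<epsilon> y Js D" "\<epsilon> > 0"
  shows "pm_box_close (6 * \<epsilon>) x y"
proof -
  obtain a I where a: "pm_parameter x a" and I: "I \<in> sets borel" "I \<subseteq> {0..1}"
    "measure lborel I \<ge> 1 - \<epsilon>" "I \<subseteq> \<Union>(set Js)"
    and aD: "\<forall>i<length Js. \<forall>j<length Js. \<forall>s\<in>I \<inter> Js ! i. \<forall>t\<in>I \<inter> Js ! j.
      \<bar>pm_dist x (a s) (a t) - \<epsilon> * D ! i ! j\<bar> \<le> 3 * \<epsilon>"
    using assms(1) unfolding distance_pattern_def by blast
  obtain b I' where b: "pm_parameter y b" and I': "I' \<in> sets borel" "I' \<subseteq> {0..1}"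
    "measure lborel I' \<ge> 1 - \<epsilon>"
    and bD: "\<forall>i<length Js. \<forall>j<length Js. \<forall>s\<in>I' \<inter> Js ! i. \<forall>t\<in>I' \<inter> Js ! j.
      \<bar>pm_dist y (b s) (b t) - \<epsilon> * D ! i ! j\<bar> \<le> 3 * \<epsilon>"
    using assms(2) unfolding distance_pattern_def by blast
  have fin: "A \<in> fmeasurable lborel" if "A \<in> sets borel" "A \<subseteq> {0..1}" for A :: "real set"
  proof (rule fmeasurableI2[of "{0..1}"])
    show "{0..1::real} \<in> fmeasurable lborel"
      by (simp add: fmeasurable_def)
  qed (use that in auto)
  have "measure lborel (I \<union> I') + measure lborel (I \<inter> I') = measure lborel I + measure lborel I'"
    using measure_Un3[OF fin[OF I(1,2)] fin[OF I'(1,2)]] by simp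
  moreover have "measure lborel (I \<union> I') \<le> measure lborel {0..1::real}"
    using I I' by (intro measure_mono_fmeasurable fin) auto
  ultimately have m: "measure lborel (I \<inter> I') \<ge> 1 - 6 * \<epsilon>"
    using I(3) I'(3) \<open>\<epsilon> > 0\<close> by simp
  have close: "\<bar>pm_dist x (a s) (a t) - pm_dist y (b s) (b t)\<bar> \<le> 6 * \<epsilon>" if st: "s \<in> I \<inter> I'" "t \<in> I \<inter> I'" for s t
  proof -
    obtain i where i: "i < length Js" "s \<in> Js ! i"
      using st(1) I(4) by (metis IntD1 UnionE in_set_conv_nth subsetD)
    obtain j where j: "j < length Js" "t \<in> Js ! j"
      using st(2) I(4) by (metis IntD1 UnionE in_set_conv_nth subsetD)
    show ?thesis
      using aD[rule_format, OF i(1) j(1), of s t] bD[rule_format, OF i(1) j(1), of s t] i(2) j(2) st by simp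
  qed
  show ?thesis
    unfolding pm_box_close_def
    by (intro exI[of _ a] exI[of _ b] exI[of _ "I \<inter> I'"] conjI a b m ballI close)
      (use I I' in auto)
qed

text \<open>Pulling back \<open>\<epsilon>\<close>-balls around dense points yields sets
  \<open>A k\<close> on which \<open>a\<close> is nearly constant. Finitely many cover up to
  \<open>\<epsilon> / 2\<close>; replacing them by members \<open>J k\<close> of \<open>\<J>\<close>
  and discarding the set \<open>U\<close> where the two disagree costs another
  \<open>\<epsilon> / 2\<close>.\<close>

lemma ex_distance_pattern:
  fixes x :: "'a pm_space"
  assumes \<J>: "\<J> \<subseteq> sets borel" "\<And>A e. A \<in> sets borel \<Longrightarrow> A \<subseteq> {0..1} \<Longrightarrow> e > 0 \<Longrightarrow>
      \<exists>J\<in>\<J>. emeasure lborel ((A - J) \<union> (J - A)) \<le> ennreal e"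
    and "\<epsilon> > 0"
  shows "\<exists>Js\<in>lists \<J>. \<exists>D. distance_pattern \<epsilon> x Js D"
proof -
  interpret MX: Metric_space "pm_points x" "pm_dist x" by simp
  let ?L = "restrict_space lborel {0..1::real}"
  interpret L: prob_space ?L
    by (rule prob_spaceI) (simp add: space_restrict_space emeasure_restrict_space)
  have setsL: "A \<in> sets ?L \<longleftrightarrow> A \<in> sets borel \<and> A \<subseteq> {0..1}" for A
    by (auto simp: sets_restrict_space_iff)
  obtain a where a: "pm_parameter x a"
    using ex_pm_parameter by blast
  obtain v :: "nat \<Rightarrow> 'a" where v: "\<And>l. v l \<in> pm_points x"
    "\<And>p e. p \<in> pm_points x \<Longrightarrow> e > 0 \<Longrightarrow> \<exists>l. pm_dist x p (v l) < e"
    by (rule pm_dense_sequence[of x]) blast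
  define A where "A k = a -` MX.mball (v k) \<epsilon> \<inter> {0..1}" for k
  have am: "a \<in> ?L \<rightarrow>\<^sub>M pm_measure x"
    using a by (simp add: pm_parameter_def)
  have AL: "A k \<in> sets ?L" for k
    using measurable_sets[OF am openin_pm_measurable[of x "MX.mball (v k) \<epsilon>"]]
    by (simp add: A_def mtopology_of_def space_restrict_space)
  have A: "A k \<in> sets borel" "A k \<subseteq> {0..1}" for k
    using AL[of k] setsL by auto
  have ball: "pm_dist x (v k) (a s) < \<epsilon>" "a s \<in> pm_points x" if "s \<in> A k" for s k
    using that by (auto simp: A_def)
  define V where "V N = (\<Union>k<N. A k)" for N :: nat
  have VL: "V N \<in> sets ?L" for N
    unfolding V_def using AL by (intro sets.finite_UN) auto
  have "(\<lambda>N. L.prob (V N)) \<longlonglongrightarrow> L.prob (\<Union>N. V N)"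
  proof (rule L.finite_Lim_measure_incseq)
    show "incseq V"
      unfolding V_def by (intro monoI UN_mono) auto
  qed (use VL in blast)
  moreover have "(\<Union>N. V N) = space ?L"
  proof
    show "(\<Union>N. V N) \<subseteq> space ?L"
      using A(2) by (auto simp: V_def space_restrict_space)
    show "space ?L \<subseteq> (\<Union>N. V N)"
    proof
      fix s assume "s \<in> space ?L"
      then have s: "s \<in> {0..1}" by (simp add: space_restrict_space)
      have as: "a s \<in> pm_points x"
        using pm_parameter_in_points[OF a s] .
      obtain k where "pm_dist x (a s) (v k) < \<epsilon>"
        using v(2)[OF as \<open>\<epsilon> > 0\<close>] ..
      then have "s \<in> A k"
        using s as v(1)[of k] MX.commute[of "a s" "v k"] by (simp add: A_def)
      then show "s \<in> (\<Union>N. V N)"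
        unfolding V_def by blast
    qed
  qed
  ultimately have "(\<lambda>N. L.prob (V N)) \<longlonglongrightarrow> 1"
    using L.prob_space by metis
  then have "\<forall>\<^sub>F N in sequentially. L.prob (V N) > 1 - \<epsilon> / 2"
    by (rule order_tendstoD) (use \<open>\<epsilon> > 0\<close> in simp)
  then obtain N where N: "L.prob (V N) > 1 - \<epsilon> / 2"
    using eventually_happens'[OF sequentially_bot] by blast
  \<comment> \<open>The error is shared among \<open>N\<close> sets; the added 1 keeps the
    denominator positive, since \<open>N = 0\<close> can occur for large
    \<open>\<epsilon>\<close>.\<close>
  define e where "e = \<epsilon> / (2 * (real N + 1))"
  have "e > 0" using \<open>\<epsilon> > 0\<close> by (simp add: e_def)
  have Ne: "real N * e \<le> \<epsilon> / 2"
  proof -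
    have "real N * e \<le> (real N + 1) * e"
      using \<open>e > 0\<close> by simp
    also have "\<dots> = \<epsilon> / 2"
      by (simp add: e_def field_simps)
    finally show ?thesis .
  qed
  have "\<forall>k. \<exists>J\<in>\<J>. emeasure lborel ((A k - J) \<union> (J - A k)) \<le> ennreal e"
    using \<J>(2)[OF A \<open>e > 0\<close>] by blast
  then obtain J where J: "\<And>k. J k \<in> \<J>"
    "\<And>k. emeasure lborel ((A k - J k) \<union> (J k - A k)) \<le> ennreal e"
    by metis
  \<comment> \<open>The sets \<open>J k\<close> may leave the unit interval, so the difference is
    cut down to it before its probability is taken.\<close>
  define E where "E k = {0..1} \<inter> ((A k - J k) \<union> (J k - A k))" for k
  have Jb: "J k \<in> sets borel" for k
    using J(1) \<J>(1) by blast
  have E: "E k \<in> sets ?L" for k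
    unfolding setsL E_def using A Jb by auto
  have Ee: "L.prob (E k) \<le> e" for k
  proof -
    have "emeasure ?L (E k) = emeasure lborel (E k)"
      by (rule emeasure_restrict_space) (auto simp: E_def)
    also have "\<dots> \<le> emeasure lborel ((A k - J k) \<union> (J k - A k))"
      unfolding E_def using A Jb by (intro emeasure_mono) auto
    also have "\<dots> \<le> ennreal e" by (rule J(2))
    finally show ?thesis
      using \<open>e > 0\<close> by (simp add: L.emeasure_eq_measure)
  qed
  define U where "U = (\<Union>k<N. E k)"
  have UL: "U \<in> sets ?L"
    unfolding U_def using E by (intro sets.finite_UN) auto
  have "L.prob U \<le> (\<Sum>k<N. L.prob (E k))"
    unfolding U_def using E by (intro L.finite_measure_subadditive_finite) auto
  also have "\<dots> \<le> (\<Sum>k<N. e)"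
    by (intro sum_mono Ee)
  also have "\<dots> \<le> \<epsilon> / 2"
    using Ne by simp
  finally have Ue: "L.prob U \<le> \<epsilon> / 2" .
  define I where "I = V N - U"
  have IL: "I \<in> sets ?L"
    unfolding I_def using VL UL by blast
  have I: "I \<in> sets borel" "I \<subseteq> {0..1}"
    using IL setsL by auto
  have "L.prob (V N) \<le> L.prob (I \<union> U)"
    by (rule L.finite_measure_mono[OF _ sets.Un[OF IL UL]]) (auto simp: I_def)
  also have "\<dots> \<le> L.prob I + L.prob U"
    using IL UL by (intro measure_subadditive) auto
  finally have "L.prob I \<ge> 1 - \<epsilon>"
    using N Ue by simp
  moreover have "L.prob I = measure lborel I"
    using I(2) by (intro measure_restrict_space) auto
  ultimately have mI: "measure lborel I \<ge> 1 - \<epsilon>"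
    by simp
  define Js where "Js = map J [0..<N]"
  define D where "D = map (\<lambda>i. map (\<lambda>j. \<lfloor>pm_dist x (v i) (v j) / \<epsilon>\<rfloor>) [0..<N]) [0..<N]"
  have IA: "s \<in> A k \<longleftrightarrow> s \<in> J k" if "s \<in> I" "k < N" for s k
    using that I(2) unfolding I_def U_def E_def by blast
  have Isub: "I \<subseteq> \<Union>(set Js)"
  proof
    fix s assume s: "s \<in> I"
    then obtain k where "k < N" "s \<in> A k"
      unfolding I_def V_def by blast
    then show "s \<in> \<Union>(set Js)"
      using IA[OF s] by (auto simp: Js_def)
  qed
  \<comment> \<open>Two of the three \<open>\<epsilon>\<close> come from replacing the points by
    ball centres, the third from rounding the distance of centres down to a multiple of
    \<open>\<epsilon>\<close>.\<close>
  have "\<bar>pm_dist x (a s) (a t) - \<epsilon> * D ! i ! j\<bar> \<le> 3 * \<epsilon>"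
    if ij: "i < length Js" "j < length Js" and s: "s \<in> I \<inter> Js ! i" and t: "t \<in> I \<inter> Js ! j" for i j s t
  proof -
    have N: "i < N" "j < N"
      using ij by (simp_all add: Js_def)
    have "s \<in> A i" "t \<in> A j"
      using s t IA N by (auto simp: Js_def)
    note s' = ball[OF this(1)] and t' = ball[OF this(2)]
    have "pm_dist x (a s) (a t) \<le> pm_dist x (v i) (a s) + pm_dist x (v i) (v j) + pm_dist x (v j) (a t)"
      using MX.triangle[of "a s" "v i" "a t"] MX.triangle[of "v i" "v j" "a t"]
        MX.commute[of "a s" "v i"] v(1) s'(2) t'(2) by simp
    moreover have "pm_dist x (v i) (v j) \<le> pm_dist x (v i) (a s) + pm_dist x (a s) (a t) + pm_dist x (v j) (a t)"
      using MX.triangle[of "v i" "a s" "v j"] MX.triangle[of "a s" "a t" "v j"]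
        MX.commute[of "a t" "v j"] v(1) s'(2) t'(2) by simp
    ultimately have "\<bar>pm_dist x (a s) (a t) - pm_dist x (v i) (v j)\<bar> \<le> 2 * \<epsilon>"
      using s'(1) t'(1) by linarith
    moreover have "\<bar>pm_dist x (v i) (v j) - \<epsilon> * D ! i ! j\<bar> \<le> \<epsilon>"
    proof -
      define \<delta> where "\<delta> = pm_dist x (v i) (v j) / \<epsilon>"
      have "\<bar>\<delta> - of_int \<lfloor>\<delta>\<rfloor>\<bar> \<le> 1"
        by linarith
      then have "\<epsilon> * \<bar>\<delta> - of_int \<lfloor>\<delta>\<rfloor>\<bar> \<le> \<epsilon> * 1"
        using \<open>\<epsilon> > 0\<close> by (intro mult_left_mono) auto
      moreover have "\<epsilon> * \<bar>\<delta> - of_int \<lfloor>\<delta>\<rfloor>\<bar> = \<bar>\<epsilon> * \<delta> - \<epsilon> * of_int \<lfloor>\<delta>\<rfloor>\<bar>"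
        using \<open>\<epsilon> > 0\<close> by (simp add: abs_mult right_diff_distrib[symmetric])
      moreover have "\<epsilon> * \<delta> = pm_dist x (v i) (v j)"
        using \<open>\<epsilon> > 0\<close> by (simp add: \<delta>_def)
      moreover have "D ! i ! j = \<lfloor>\<delta>\<rfloor>"
        using N by (simp add: D_def \<delta>_def)
      ultimately show ?thesis by simp
    qed
    ultimately show ?thesis by linarith
  qed
  then have "distance_pattern \<epsilon> x Js D"
    unfolding distance_pattern_def using a I mI Isub by blast
  moreover have "Js \<in> lists \<J>"
    using J(1) by (auto simp: Js_def)
  ultimately show ?thesis by blast
qed

text \<open>For each of the countably many triples of scale, sets and matrix that occur in
  \<open>P\<close>, one member of \<open>P\<close> having it is picked. Every \<open>X\<close> in
  \<open>P\<close> shares a triple of each fine scale with a pick, so the dense set lies inside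
  \<open>P\<close>.\<close>

lemma countable_box_dense_subset:
  fixes P :: "mm_class set"
  obtains Q where "countable Q" "Q \<subseteq> P" "\<And>X e. X \<in> P \<Longrightarrow> e > 0 \<Longrightarrow> \<exists>Y\<in>Q. box_dist Y X < e"
proof -
  obtain \<J> :: "real set set" where \<J>: "countable \<J>" "\<J> \<subseteq> sets borel"
    "\<And>A e. A \<in> sets borel \<Longrightarrow> A \<subseteq> {0..1} \<Longrightarrow> e > 0 \<Longrightarrow>
      \<exists>J\<in>\<J>. emeasure lborel ((A - J) \<union> (J - A)) \<le> ennreal e"
    by (rule countable_approximating_borel_sets) blast
  define has where "has Y = (\<lambda>(n, Js, D). \<exists>y. represents y Y \<and> distance_pattern (1 / real (Suc n)) y Js D)" for Y
  define T where "T = {\<tau> \<in> UNIV \<times> lists \<J> \<times> UNIV. \<exists>Y\<in>P. has Y \<tau>}"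
  have "countable (UNIV \<times> lists \<J> \<times> UNIV :: (nat \<times> real set list \<times> int list list) set)"
    using \<J>(1) by (intro countable_SIGMA countable_lists) auto
  then have T: "countable T"
    by (rule countable_subset[rotated]) (auto simp: T_def)
  have "\<forall>\<tau>\<in>T. \<exists>Y. Y \<in> P \<and> has Y \<tau>"
    by (auto simp: T_def)
  then obtain f where f: "\<And>\<tau>. \<tau> \<in> T \<Longrightarrow> f \<tau> \<in> P \<and> has (f \<tau>) \<tau>"
    by metis
  show ?thesis
  proof (rule that[of "f ` T"])
    show "countable (f ` T)" using T by (rule countable_image)
    show "f ` T \<subseteq> P" using f by blast
    fix X and e :: ennreal assume X: "X \<in> P" and "e > 0"
    obtain x where x: "represents x X"
      using ex_represents ..
    obtain r where r: "r > 0" "ennreal r < e"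
    proof (cases e)
      case (real r)
      then show ?thesis
        using \<open>e > 0\<close> by (intro that[of "r / 2"]) (auto simp: ennreal_less_iff)
    qed (auto intro: that[of 1])
    \<comment> \<open>A common pattern at scale \<open>\<epsilon>\<close> yields box-closeness only
      up to \<open>6 * \<epsilon>\<close>.\<close>
    obtain n where n: "1 / real (Suc n) < r / 6"
      using reals_Archimedean[of "r / 6"] r by (auto simp: inverse_eq_divide)
    define \<epsilon> where "\<epsilon> = 1 / real (Suc n)"
    have \<epsilon>: "\<epsilon> > 0" "6 * \<epsilon> < r"
      using n by (simp_all add: \<epsilon>_def)
    obtain Js D where Js: "Js \<in> lists \<J>" "distance_pattern \<epsilon> x Js D"
      using ex_distance_pattern[OF \<J>(2,3) \<epsilon>(1), of x] by blast
    have \<tau>: "(n, Js, D) \<in> T"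
      unfolding T_def has_def using X x Js by (auto simp: \<epsilon>_def)
    obtain y where y: "represents y (f (n, Js, D))" "distance_pattern \<epsilon> y Js D"
      using f[OF \<tau>] by (auto simp: has_def \<epsilon>_def)
    have "box_dist (f (n, Js, D)) X \<le> ennreal (6 * \<epsilon>)"
      using \<epsilon>(1) by (intro box_dist_le[OF y(1) x] distance_pattern_imp_box_close[OF y(2) Js(2)]) auto
    also have "\<dots> < ennreal r"
      using \<epsilon> by (simp add: ennreal_less_iff)
    also have "\<dots> < e" by (rule r(2))
    finally show "\<exists>Y\<in>f ` T. box_dist Y X < e"
      using \<tau> by blast
  qed
qed

section \<open>Exhausting a pyramid by pyramids of single spaces\<close>

lemma ex_dominating_chain:
  fixes Q :: "nat \<Rightarrow> mm_class"
  assumes P: "P \<in> pyramids" and Q: "\<And>n. Q n \<in> P"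
  obtains Z where "\<And>n. Z n \<in> P" "\<And>k n. k \<le> n \<Longrightarrow> Q k \<preceq>\<^sub>L Z n"
proof -
  have dir: "\<exists>C\<in>P. A \<preceq>\<^sub>L C \<and> B \<preceq>\<^sub>L C" if "A \<in> P" "B \<in> P" for A B
    using P that unfolding pyramids_def by blast
  \<comment> \<open>Directedness bounds two elements at a time, so each new space is chosen above
    its predecessor and the next \<open>Q\<close>; transitivity keeps all earlier \<open>Q k\<close>
    below it.\<close>
  have "\<exists>Z. \<forall>n. (Z n \<in> P \<and> Q n \<preceq>\<^sub>L Z n) \<and> Z n \<preceq>\<^sub>L Z (Suc n)"
  proof (rule dependent_nat_choice)
    show "\<exists>C. C \<in> P \<and> Q 0 \<preceq>\<^sub>L C"
      using Q lip_le_refl by blast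
    show "\<exists>C. (C \<in> P \<and> Q (Suc n) \<preceq>\<^sub>L C) \<and> B \<preceq>\<^sub>L C" if "B \<in> P \<and> Q n \<preceq>\<^sub>L B" for B and n :: nat
      using dir[of B "Q (Suc n)"] that Q by blast
  qed
  then obtain Z where Z: "\<And>n. Z n \<in> P" "\<And>n. Q n \<preceq>\<^sub>L Z n" "\<And>n. Z n \<preceq>\<^sub>L Z (Suc n)"
    by blast
  have "Q k \<preceq>\<^sub>L Z n" if "k \<le> n" for k n
    using that
  proof (induction n rule: dec_induct)
    case (step n)
    then show ?case using lip_le_trans Z(3) by blast
  qed (rule Z(2))
  then show ?thesis
    using Z(1) that by blast
qed

lemma pyramid_exhaustion:
  assumes P: "P \<in> pyramids"
  obtains Z where "\<And>n. Z n \<in> P" "weakly_converges (\<lambda>n. pyramid_of (Z n)) P"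
proof -
  obtain D where D: "countable D" "D \<subseteq> P" "\<And>X e. X \<in> P \<Longrightarrow> e > 0 \<Longrightarrow> \<exists>Y\<in>D. box_dist Y X < e"
    by (rule countable_box_dense_subset[of P]) blast
  obtain X0 where "X0 \<in> P"
    using P unfolding pyramids_def by blast
  then have "D \<noteq> {}"
    using D(3)[of X0 1] by auto
  define Q where "Q = from_nat_into D"
  have Q: "range Q = D"
    unfolding Q_def using D(1) \<open>D \<noteq> {}\<close> by (simp add: range_from_nat_into)
  have QP: "Q n \<in> P" for n
    using Q D(2) by blast
  obtain Z where Z: "\<And>n. Z n \<in> P" "\<And>k n. k \<le> n \<Longrightarrow> Q k \<preceq>\<^sub>L Z n"
    by (rule ex_dominating_chain[OF P, of Q]) (use QP in blast)+
  have sub: "pyramid_of (Z n) \<subseteq> P" for n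
    using P Z(1)[of n] unfolding pyramids_def pyramid_of_def by blast
  have "\<exists>Xs. (\<forall>n. Xs n \<in> pyramid_of (Z n)) \<and> (\<lambda>n. box_dist (Xs n) X) \<longlonglongrightarrow> 0" if X: "X \<in> P" for X
  proof -
    \<comment> \<open>The best approximation among \<open>Q 0, ..., Q n\<close>, all of which lie in
      \<open>pyramid_of (Z n)\<close>. Once a good \<open>Q k\<close> has appeared it stays
      available, so the distance never grows again.\<close>
    define Xs where "Xs n = Q (arg_min_on (\<lambda>k. box_dist (Q k) X) {..n})" for n
    have "arg_min_on (\<lambda>k. box_dist (Q k) X) {..n} \<in> {..n}" for n
      by (intro arg_min_if_finite(1)) auto
    then have "Xs n \<in> pyramid_of (Z n)" for n
      using Z(2) by (auto simp: Xs_def pyramid_of_def)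
    moreover have "(\<lambda>n. box_dist (Xs n) X) \<longlonglongrightarrow> 0"
    proof (rule order_tendstoI)
      fix e :: ennreal assume "e > 0"
      then obtain k where k: "box_dist (Q k) X < e"
        using D(3)[OF X] Q by blast
      have "box_dist (Xs n) X < e" if "n \<ge> k" for n
      proof -
        have "box_dist (Xs n) X \<le> box_dist (Q k) X"
          unfolding Xs_def using that arg_min_least[of "{..n}" k "\<lambda>k. box_dist (Q k) X"] by simp
        then show ?thesis using k by (rule le_less_trans)
      qed
      then show "\<forall>\<^sub>F n in sequentially. box_dist (Xs n) X < e"
        by (auto simp: eventually_sequentially)
    qed simp
    ultimately show ?thesis by blast
  qed
  moreover have "liminf (\<lambda>n. INF Y\<in>pyramid_of (Z n). box_dist X Y) > 0" if X: "X \<notin> P" for X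
  proof -
    have "openin box_topology (topspace box_topology - P)"
      using P by (simp add: pyramids_def closedin_def)
    then obtain e where e: "e > 0" "\<And>Y. box_dist X Y < e \<Longrightarrow> Y \<notin> P"
      unfolding openin_box_topology topspace_box_topology using X by blast
    \<comment> \<open>The bound is uniform in \<open>n\<close>: a box ball around \<open>X\<close>
      that misses \<open>P\<close> misses every pyramid contained in \<open>P\<close>.\<close>
    have "e \<le> (INF Y\<in>pyramid_of (Z n). box_dist X Y)" for n
    proof (rule INF_greatest)
      fix Y assume "Y \<in> pyramid_of (Z n)"
      then show "e \<le> box_dist X Y"
        using e(2)[of Y] sub[of n] by (meson not_le subsetD)
    qed
    then have "e \<le> liminf (\<lambda>n. INF Y\<in>pyramid_of (Z n). box_dist X Y)"
      by (intro Liminf_bounded always_eventually allI)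
    with e(1) show ?thesis by (rule less_le_trans)
  qed
  ultimately have "weakly_converges (\<lambda>n. pyramid_of (Z n)) P"
    unfolding weakly_converges_def by blast
  with Z(1) show ?thesis by (rule that)
qed

theorem corollary3p3:
  fixes F :: "mm_class \<Rightarrow> ennreal" and G :: "mm_class set \<Rightarrow> ennreal"
  assumes "monotone (\<preceq>\<^sub>L) (\<le>) F"
    and "lower_semicontinuous box_topology F"
    and "monotone_on pyramids (\<subseteq>) (\<le>) G"
    and "lower_semicontinuous weak_topology G"
    and "\<And>X. G (pyramid_of X) = F X"
  shows "\<forall>P\<in>pyramids. G P = (SUP X\<in>P. F X)"
proof
  fix P assume P: "P \<in> pyramids"
  show "G P = (SUP X\<in>P. F X)"
  proof (rule antisym)
    show "(SUP X\<in>P. F X) \<le> G P"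
    proof (rule SUP_least)
      fix X assume "X \<in> P"
      then have "pyramid_of X \<subseteq> P"
        using P unfolding pyramids_def pyramid_of_def by blast
      then have "G (pyramid_of X) \<le> G P"
        using monotone_onD[OF assms(3) pyramid_of_in_pyramids P] by blast
      then show "F X \<le> G P"
        by (simp add: assms(5))
    qed
    obtain Z where Z: "\<And>n. Z n \<in> P" "weakly_converges (\<lambda>n. pyramid_of (Z n)) P"
      by (rule pyramid_exhaustion[OF P]) blast
    show "G P \<le> (SUP X\<in>P. F X)"
    proof (rule dense_le)
      fix c assume c: "c < G P"
      have "openin weak_topology {Q \<in> pyramids. c < G Q}"
        using assms(4) by (simp add: lower_semicontinuous_def topspace_weak_topology)
      \<comment> \<open>Open sets of \<open>weak_topology\<close> are sequentially open, so the
        superlevel set, which contains \<open>P\<close>, captures the exhausting pyramids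
        eventually; one of them suffices for each \<open>c\<close>.\<close>
      then have "(\<forall>n. Ps n \<in> pyramids) \<and> weakly_converges Ps P \<Longrightarrow>
          \<forall>\<^sub>F n in sequentially. Ps n \<in> {Q \<in> pyramids. c < G Q}" for Ps
        using P c unfolding openin_weak_topology by auto
      from this[of "\<lambda>n. pyramid_of (Z n)"]
      have "\<forall>\<^sub>F n in sequentially. pyramid_of (Z n) \<in> {Q \<in> pyramids. c < G Q}"
        using Z(2) pyramid_of_in_pyramids by simp
      then obtain n where "c < G (pyramid_of (Z n))"
        using eventually_happens'[OF sequentially_bot] by blast
      also have "\<dots> \<le> (SUP X\<in>P. F X)"
        unfolding assms(5) by (intro SUP_upper Z(1))
      finally show "c \<le> (SUP X\<in>P. F X)"
        by (rule less_imp_le)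
    qed
  qed
qed

end
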